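(* Let $\mathcal{A}=\{H_1,\dots,H_n\}$ be a central hyperplane arrangement in $\mathbb{Q}^l$, with $H_i=\alpha_i^{-1}(0)$, where the linear forms $\alpha_i\in\mathbb{Z}[x_1,\dots,x_l]$ are chosen so that no prime number divides any $\alpha_i$. Let $p$ be a prime number that is good for $\mathcal{A}$, does not divide $n$, and is a non-zero divisor in $\mathbb{Z}[x_1,\dots,x_l]/J(\mathcal{A})_{\mathbb{Z}}$. If $\mathcal{A}_p$ is free in $\mathbb{F}_p^l$ with exponents $(e_1,\dots,e_l)$, then $\mathcal{A}$ is free in $\mathbb{Q}^l$ with exponents $(e_1,\dots,e_l)$.
   Context: Let $K$ be a field and $S=K[x_1,\dots,x_l]$. A central hyperplane arrangement $\mathcal{B}$ in $K^l$ is a finite set of (distinct) hyperplanes through the origin, each given as $H=\beta_H^{-1}(0)$ with $\beta_H\in S$ a nonzero linear form. Let $\mathrm{Der}_{K^l}=\{\sum_{i=1}^l f_i\partial_{x_i}\mid f_i\in S\}$. A derivation $\delta=\sum_i f_i\partial_{x_i}$ is homogeneous of polynomial degree $d$, written $\mathrm{pdeg}(\delta)=d$, if all $f_i$ are homogeneous of degree $d$. The module of logarithmic vector fields is $D(\mathcal{B})=\{\delta\in\mathrm{Der}_{K^l}\mid \delta(\beta_H)\in(\beta_H)S \text{ for all } H\in\mathcal{B}\}$. The arrangement $\mathcal{B}$ is free with exponents $(e_1,\dots,e_l)$ if $D(\mathcal{B})$ is a free $S$-module having a basis $\delta_1,\dots,\delta_l$ of homogeneous derivations with $\mathrm{pdeg}(\delta_i)=e_i$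 (exponents are considered up to order). For the arrangement $\mathcal{A}$ in $\mathbb{Q}^l$: after clearing denominators and common factors, each $H_i$ is given by a linear form $\alpha_i$ with integer coefficients such that no prime divides $\alpha_i$; put $Q(\mathcal{A})=\prod_{i=1}^n\alpha_i\in\mathbb{Z}[x_1,\dots,x_l]$. For a prime $p$ let $\pi_p\colon\mathbb{Z}[x_1,\dots,x_l]\to\mathbb{F}_p[x_1,\dots,x_l]$ be the canonical homomorphism (reduction modulo $p$). The prime $p$ is good for $\mathcal{A}$ if $\pi_p(Q(\mathcal{A}))$ is reduced (square-free). For a good prime $p$, $\mathcal{A}_p$ is the central arrangement in $\mathbb{F}_p^l$ defined by $\pi_p(Q(\mathcal{A}))$, i.e. consisting of the hyperplanes $\pi_p(\alpha_i)=0$, $i=1,\dots,n$. $J(\mathcal{A})_{\mathbb{Z}}$ denotes the ideal of $\mathbb{Z}[x_1,\dots,x_l]$ generated by $Q(\mathcal{A})$ and its partial derivatives $\partial Q(\mathcal{A})/\partial x_i$, $i=1,\dots,l$. For an ideal $I$ of $R=\mathbb{Z}[x_1,\dots,x_l]$, a prime number $p$ is a zero divisor in $R/I$ if there is $f\in R\setminus I$ with $pf\in I$, and a non-zero divisor otherwise. *)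

theory Defs
  imports
    "HOL-Library.Poly_Mapping"
    "HOL-Computational_Algebra.Squarefree"
    "HOL-Analysis.Finite_Cartesian_Product"
    "Berlekamp_Zassenhaus.Finite_Field"
begin

text \<open>
  The polynomial ring in finitely many variables, indexed by a finite type \<open>'l\<close>,
  is the ring of finitely supported functions from exponent vectors to coefficients.
  The dimension is \<open>CARD('l)\<close>. The prime field with \<open>p\<close> elements is \<open>'p mod_ring\<close>, where
  \<open>'p\<close> is a type with \<open>p\<close> elements.
\<close>

type_synonym ('l, 'a) mpoly = "('l \<Rightarrow>\<^sub>0 nat) \<Rightarrow>\<^sub>0 'a"

definition mpoly_eval :: "('l::finite, 'a::comm_semiring_1) mpoly \<Rightarrow> 'a ^ 'l \<Rightarrow> 'a" where
  "mpoly_eval f v =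
     (\<Sum>m\<in>Poly_Mapping.keys f. Poly_Mapping.lookup f m * (\<Prod>i\<in>UNIV. (v $ i) ^ Poly_Mapping.lookup m i))"

definition mpoly_partial :: "'l \<Rightarrow> ('l::finite, 'a::comm_semiring_1) mpoly \<Rightarrow> ('l, 'a) mpoly" where
  "mpoly_partial i f =
     (\<Sum>m\<in>Poly_Mapping.keys f.
        Poly_Mapping.single (m - Poly_Mapping.single i 1)
          (of_nat (Poly_Mapping.lookup m i) * Poly_Mapping.lookup f m))"

text \<open>As usual, the zero polynomial is homogeneous of every degree.\<close>

definition homogeneous :: "nat \<Rightarrow> ('l::finite, 'a::zero) mpoly \<Rightarrow> bool" where
  "homogeneous d f \<longleftrightarrow> (\<forall>m\<in>Poly_Mapping.keys f. (\<Sum>i\<in>UNIV. Poly_Mapping.lookup m i) = d)"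

text \<open>
  The canonical map induced by the unique ring homomorphism from the integers; for coefficients
  in \<open>'p mod_ring\<close> it is the reduction modulo \<open>p\<close>.
\<close>

definition mpoly_of_int :: "('l, int) mpoly \<Rightarrow> ('l, 'a::ring_1) mpoly" where
  "mpoly_of_int = Poly_Mapping.map of_int"

definition zero_locus :: "('l::finite, 'a::comm_semiring_1) mpoly \<Rightarrow> ('a ^ 'l) set" where
  "zero_locus f = {v. mpoly_eval f v = 0}"

definition defining_form :: "('l::finite, 'a::field) mpoly \<Rightarrow> ('a ^ 'l) set \<Rightarrow> bool" where
  "defining_form \<beta> H \<longleftrightarrow> homogeneous 1 \<beta> \<and> \<beta> \<noteq> 0 \<and> H = zero_locus \<beta>"

definition central_arrangement :: "('a::field ^ 'l::finite) set set \<Rightarrow> bool" where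
  "central_arrangement B \<longleftrightarrow> finite B \<and> (\<forall>H\<in>B. \<exists>\<beta>. defining_form \<beta> H)"

text \<open>
  The derivation with coefficients \<open>f\<^sub>i\<close> is represented by the vector of the \<open>f\<^sub>i\<close>,
  so that the module of derivations is the type \<open>('l, 'a) mpoly ^ 'l\<close>.
\<close>

definition deriv_apply ::
  "('l::finite, 'a::comm_semiring_1) mpoly ^ 'l \<Rightarrow> ('l, 'a) mpoly \<Rightarrow> ('l, 'a) mpoly" where
  "deriv_apply \<delta> f = (\<Sum>i\<in>UNIV. (\<delta> $ i) * mpoly_partial i f)"

definition has_pdeg :: "('l::finite, 'a::zero) mpoly ^ 'l \<Rightarrow> nat \<Rightarrow> bool" where
  "has_pdeg \<delta> d \<longleftrightarrow> (\<forall>i. homogeneous d (\<delta> $ i))"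

text \<open>
  A defining form of a hyperplane is unique up to a nonzero scalar, so quantifying over all
  defining forms amounts to choosing one for each hyperplane.
\<close>

definition log_derivations ::
  "('a::field ^ 'l::finite) set set \<Rightarrow> (('l, 'a) mpoly ^ 'l) set" where
  "log_derivations B = {\<delta>. \<forall>H\<in>B. \<forall>\<beta>. defining_form \<beta> H \<longrightarrow> \<beta> dvd deriv_apply \<delta> \<beta>}"

global_interpretation vec_mod: Modules.module "(*s) :: 'a::comm_ring_1 \<Rightarrow> 'a ^ 'n \<Rightarrow> 'a ^ 'n"
  by standard (simp_all add: vec_eq_iff algebra_simps)

global_interpretation ring_mod: Modules.module "(*) :: 'a::comm_ring_1 \<Rightarrow> 'a \<Rightarrow> 'a"
  by standard (simp_all add: algebra_simps)

text \<open>
  The basis and the exponents are indexed by \<open>'l\<close>, so there are exactly \<open>CARD('l)\<close>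
  of them, and their order is immaterial.
\<close>

definition free_with_exponents ::
  "('a::field ^ 'l::finite) set set \<Rightarrow> ('l \<Rightarrow> nat) \<Rightarrow> bool" where
  "free_with_exponents B e \<longleftrightarrow>
     (\<exists>\<delta> :: 'l \<Rightarrow> ('l, 'a) mpoly ^ 'l.
        inj \<delta> \<and> vec_mod.independent (range \<delta>) \<and> vec_mod.span (range \<delta>) = log_derivations B \<and>
        (\<forall>i. has_pdeg (\<delta> i) (e i)))"

definition arrangement_poly :: "(nat \<Rightarrow> ('l, int) mpoly) \<Rightarrow> nat \<Rightarrow> ('l, int) mpoly" where
  "arrangement_poly \<alpha> n = (\<Prod>i = 1..n. \<alpha> i)"

definition reduced_arrangement ::
  "(nat \<Rightarrow> ('l::finite, int) mpoly) \<Rightarrow> nat \<Rightarrow> ('p::prime_card mod_ring ^ 'l) set set" where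
  "reduced_arrangement \<alpha> n = (\<lambda>i. zero_locus (mpoly_of_int (\<alpha> i))) ` {1..n}"

definition jacobian_ideal :: "('l::finite, int) mpoly \<Rightarrow> ('l, int) mpoly set" where
  "jacobian_ideal Q = ring_mod.span (insert Q (range (\<lambda>i. mpoly_partial i Q)))"

definition zero_divisor_mod :: "'a::comm_ring_1 \<Rightarrow> 'a set \<Rightarrow> bool" where
  "zero_divisor_mod r I \<longleftrightarrow> (\<exists>f. f \<notin> I \<and> r * f \<in> I)"

end

theory Submission
  imports Defs
begin

text \<open>
  A derivation \<open>\<delta>\<close> in \<open>D(A\<^sub>p)\<close> satisfies \<open>\<delta>(Q) \<in> (Q)\<close> modulo \<open>p\<close>. For an arbitrary integral lift \<open>\<theta>\<close> the
  error term in \<open>\<theta>(Q) = h Q + p g\<close> satisfies \<open>p g \<in> J\<close>, hence \<open>g \<in> J\<close>, and the lift can be corrected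
  so that \<open>\<theta>(Q) \<in> (Q)\<close> over the integers. Conversely, integral elements of \<open>D(A)\<close> reduce to \<open>D(A\<^sub>p)\<close>.
  So a homogeneous basis of \<open>D(A\<^sub>p)\<close> lifts to integral homogeneous derivations \<open>\<theta>\<^sub>i\<close> of the same degrees
  that are independent and generate the integral part of \<open>D(A)\<close> modulo \<open>p\<close>. In each degree this part
  lies in a finitely generated abelian group, so a Nakayama-type descent shows that the \<open>\<theta>\<^sub>i\<close>
  generate \<open>D(A)\<close> over the rational numbers.
\<close>

subsection \<open>Polynomials as sums of monomials\<close>

text \<open>The hypothesis on the Jacobian ideal concerns \<open>Q\<close> alone, whereas membership
  in D(A) is a condition on each linear form. Passing from the forms to \<open>Q\<close> is the
  Leibniz rule and is done modulo \<open>p\<close>; returning to the forms is done over the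
  rationals, where distinct hyperplanes have non-proportional forms. Generation modulo
  \<open>p\<close> leaves an error that can be divided by \<open>p\<close> and expanded again
  without end, so iteration alone never yields a finite combination. The descent therefore tests
  elements by a rational linear functional that kills the span of the lifts. The grading enters
  here: one degree has finitely many monomials, hence one denominator serves for all values of the
  functional. Lifts and corrections can destroy homogeneity, so homogeneous components are taken
  again after each of them.\<close>

lemma mpoly_expand:
  fixes f :: "'b \<Rightarrow>\<^sub>0 'a::comm_monoid_add"
  shows "f = (\<Sum>m\<in>Poly_Mapping.keys f. Poly_Mapping.single m (Poly_Mapping.lookup f m))"
proof (rule poly_mapping_eqI)
  fix k
  have "Poly_Mapping.lookup (\<Sum>m\<in>Poly_Mapping.keys f. Poly_Mapping.single m (Poly_Mapping.lookup f m)) k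
      = (\<Sum>m\<in>Poly_Mapping.keys f. if m = k then Poly_Mapping.lookup f m else 0)"
    unfolding lookup_sum by (intro sum.cong) (auto simp: lookup_single when_def)
  also have "\<dots> = Poly_Mapping.lookup f k"
    by (auto simp: sum.delta' in_keys_iff)
  finally show "Poly_Mapping.lookup f k = Poly_Mapping.lookup
    (\<Sum>m\<in>Poly_Mapping.keys f. Poly_Mapping.single m (Poly_Mapping.lookup f m)) k" ..
qed

text \<open>The zero polynomial is the monomial with coefficient 0, so it has no case of its own;
  identities that are additive in each argument reduce to monomials.\<close>

lemma mpoly_induct [case_names single add]:
  fixes f :: "'b \<Rightarrow>\<^sub>0 'a::comm_monoid_add"
  assumes single: "\<And>m c. P (Poly_Mapping.single m c)"
    and add: "\<And>f g. P f \<Longrightarrow> P g \<Longrightarrow> P (f + g)"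
  shows "P f"
proof -
  have "P (\<Sum>m\<in>A. Poly_Mapping.single m (Poly_Mapping.lookup f m))" if "finite A" for A
    using that
  proof (induction A rule: finite_induct)
    case empty
    then show ?case using single[of _ 0] by simp
  qed (auto intro: assms)
  then show ?thesis
    using mpoly_expand[of f] by (metis finite_keys)
qed

text \<open>Reading the coefficient at \<open>a + m\<close> lets \<open>a\<close> cancel, so no case
  distinction on divisibility by the monomial \<open>a\<close> arises.\<close>

lemma lookup_single_mult_shift:
  fixes f :: "('l, 'a::semiring_0) mpoly"
  shows "Poly_Mapping.lookup (Poly_Mapping.single a c * f) (a + m) = c * Poly_Mapping.lookup f m"
proof (induction f rule: mpoly_induct)
  case (single b d)
  then show ?case
    by (simp add: mult_single lookup_single when_def)
qed (simp add: distrib_left lookup_add)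

lemma lookup_const_mult:
  fixes f :: "('l, 'a::semiring_0) mpoly"
  shows "Poly_Mapping.lookup (Poly_Mapping.single 0 c * f) m = c * Poly_Mapping.lookup f m"
  using lookup_single_mult_shift[of 0 c f m] by simp

lemma single_mult_single_0:
  fixes c :: "'a::semiring_0"
  shows "Poly_Mapping.single 0 c * Poly_Mapping.single m d = Poly_Mapping.single m (c * d)"
  by (simp add: mult_single)


subsection \<open>Change of coefficients\<close>

lemma lookup_mpoly_of_int [simp]:
  "Poly_Mapping.lookup (mpoly_of_int f :: ('l, 'a::ring_1) mpoly) m = of_int (Poly_Mapping.lookup f m)"
  unfolding mpoly_of_int_def by (simp add: Poly_Mapping.map.rep_eq when_def)

lemma mpoly_of_int_0 [simp]: "mpoly_of_int 0 = 0"
  by (rule poly_mapping_eqI) simp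

lemma mpoly_of_int_single [simp]:
  "mpoly_of_int (Poly_Mapping.single m c) = Poly_Mapping.single m (of_int c)"
  by (rule poly_mapping_eqI) (simp add: lookup_single when_def)

lemma mpoly_of_int_add [simp]: "mpoly_of_int (f + g) = mpoly_of_int f + mpoly_of_int g"
  by (rule poly_mapping_eqI) (simp add: lookup_add)

lemma mpoly_of_int_diff [simp]: "mpoly_of_int (f - g) = mpoly_of_int f - mpoly_of_int g"
  by (rule poly_mapping_eqI) (simp add: lookup_minus)

lemma mpoly_of_int_sum [simp]: "mpoly_of_int (\<Sum>x\<in>A. f x) = (\<Sum>x\<in>A. mpoly_of_int (f x))"
  by (rule poly_mapping_eqI) (simp add: lookup_sum)

lemma mpoly_of_int_1 [simp]: "mpoly_of_int 1 = 1"
  using mpoly_of_int_single[of 0 1] by simp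

lemma mpoly_of_int_mult [simp]:
  "(mpoly_of_int (f * g) :: ('l, 'a::ring_1) mpoly) = mpoly_of_int f * mpoly_of_int g"
proof (induction f rule: mpoly_induct)
  case (single a c)
  show ?case
    by (induction g rule: mpoly_induct) (simp_all add: mult_single distrib_left)
qed (simp add: distrib_right)

lemma mpoly_of_int_prod [simp]:
  "(mpoly_of_int (\<Prod>x\<in>A. f x) :: ('l, 'a::comm_ring_1) mpoly) = (\<Prod>x\<in>A. mpoly_of_int (f x))"
  by (induction A rule: infinite_finite_induct) simp_all

lemma mpoly_of_int_of_nat: "mpoly_of_int (of_nat k) = of_nat k"
  by (metis mpoly_of_int_single of_int_of_nat_eq single_of_nat)

lemma mpoly_of_int_rat_inject [simp]:
  "(mpoly_of_int f :: ('l, rat) mpoly) = mpoly_of_int g \<longleftrightarrow> f = g"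
  by (auto simp: poly_mapping_eq_iff fun_eq_iff dest!: arg_cong[where f = Poly_Mapping.lookup])

lemma mpoly_of_int_surj_mod:
  obtains g where "(mpoly_of_int g :: ('l, 'p::prime_card mod_ring) mpoly) = f"
proof -
  have "\<exists>g. (mpoly_of_int g :: ('l, 'p mod_ring) mpoly) = f"
  proof (induction f rule: mpoly_induct)
    case (single m c)
    then show ?case
      by (metis mpoly_of_int_single of_int_of_int_mod_ring of_int_mod_ring_to_int_mod_ring)
  next
    case (add f g)
    then show ?case
      by (metis mpoly_of_int_add)
  qed
  with that show thesis by blast
qed

lemma of_int_mod_ring_eq_0_iff:
  "(of_int z :: 'p::prime_card mod_ring) = 0 \<longleftrightarrow> int CARD('p) dvd z"
  unfolding of_int_of_int_mod_ring
  by transfer (simp add: dvd_eq_mod_eq_0)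

text \<open>The kernel of reduction is generated by \<open>p\<close>, as coefficients can be divided
  one by one. Every vanishing modulo \<open>p\<close> is turned into a factor \<open>p\<close>
  through this equivalence.\<close>

lemma mpoly_of_int_mod_eq_0_iff:
  "(mpoly_of_int f :: ('l, 'p::prime_card mod_ring) mpoly) = 0 \<longleftrightarrow> of_nat CARD('p) dvd f"
proof
  assume "of_nat CARD('p) dvd f"
  then obtain g where "f = of_nat CARD('p) * g" by blast
  moreover have "(of_nat CARD('p) :: 'p mod_ring) = 0"
    using of_int_mod_ring_eq_0_iff[where 'p = 'p, of "int CARD('p)"] by simp
  ultimately show "(mpoly_of_int f :: ('l, 'p mod_ring) mpoly) = 0"
    by (metis mpoly_of_int_mult mpoly_of_int_of_nat mult_zero_left single_of_nat single_zero)
next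
  assume *: "(mpoly_of_int f :: ('l, 'p mod_ring) mpoly) = 0"
  have dvd: "int CARD('p) dvd Poly_Mapping.lookup f m" for m
    using arg_cong[OF *, of "\<lambda>h. Poly_Mapping.lookup h m"] by (simp add: of_int_mod_ring_eq_0_iff)
  define g where "g = (\<Sum>m\<in>Poly_Mapping.keys f. Poly_Mapping.single m (Poly_Mapping.lookup f m div int CARD('p)))"
  have "of_nat CARD('p) * g = f"
    unfolding g_def
    using mpoly_expand[of f]
    by (simp add: sum_distrib_left single_mult_single_0 dvd flip: single_of_nat)
  then show "of_nat CARD('p) dvd f"
    by (metis dvd_triv_left)
qed

lemma const_of_int_mult:
  "(Poly_Mapping.single 0 (of_int (a * b)) :: ('l, 'a::comm_ring_1) mpoly)
    = Poly_Mapping.single 0 (of_int a) * Poly_Mapping.single 0 (of_int b)"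
  by (simp add: mult_single del: single_of_int)

text \<open>Denominators are multiplied up twice, over the monomials of one polynomial and over the
  index set, so that a whole derivation or relation becomes integral with a single constant.\<close>

lemma clear_denominators:
  fixes f :: "'b \<Rightarrow> ('l, rat) mpoly"
  assumes "finite A"
  obtains c g where "c > (0::int)"
    "\<And>x. x \<in> A \<Longrightarrow> Poly_Mapping.single 0 (of_int c) * f x = mpoly_of_int (g x)"
proof -
  have one: "\<exists>c>0::int. \<exists>g. Poly_Mapping.single 0 (of_int c) * h = mpoly_of_int g" for h :: "('l, rat) mpoly"
  proof (induction h rule: mpoly_induct)
    case (single m r)
    obtain a b where "r = Rat.Fract a b" "b > 0" by (cases r) auto
    then have "Poly_Mapping.single 0 (of_int b) * Poly_Mapping.single m r
      = mpoly_of_int (Poly_Mapping.single m a)"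
      by (simp add: single_mult_single_0 Fract_of_int_quotient del: single_of_int)
    with \<open>b > 0\<close> show ?case by blast
  next
    case (add f g)
    then obtain a b f' g' where ab: "a > 0" "b > 0"
      and f': "Poly_Mapping.single 0 (of_int a) * f = mpoly_of_int f'"
      and g': "Poly_Mapping.single 0 (of_int b) * g = mpoly_of_int g'" by blast
    have "Poly_Mapping.single 0 (of_int (a * b)) * (f + g)
        = Poly_Mapping.single 0 (of_int b) * (Poly_Mapping.single 0 (of_int a) * f)
          + Poly_Mapping.single 0 (of_int a) * (Poly_Mapping.single 0 (of_int b) * g)"
      unfolding const_of_int_mult by (simp only: algebra_simps)
    also have "\<dots> = mpoly_of_int (Poly_Mapping.single 0 b * f' + Poly_Mapping.single 0 a * g')"
      by (simp only: f' g' mpoly_of_int_add mpoly_of_int_mult mpoly_of_int_single)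
    finally show ?case using ab by (meson mult_pos_pos)
  qed
  have "\<exists>c>0::int. \<forall>x\<in>A. \<exists>g. Poly_Mapping.single 0 (of_int c) * f x = mpoly_of_int g"
    using assms
  proof (induction A rule: finite_induct)
    case empty
    then show ?case by (auto intro: exI[of _ 1])
  next
    case (insert x A)
    then obtain a where a: "a > 0" "\<forall>x\<in>A. \<exists>g. Poly_Mapping.single 0 (of_int a) * f x = mpoly_of_int g"
      by blast
    obtain b g where b: "b > 0" "Poly_Mapping.single 0 (of_int b) * f x = mpoly_of_int g"
      using one by blast
    have "\<exists>g. Poly_Mapping.single 0 (of_int (a * b)) * f y = mpoly_of_int g" if y: "y \<in> insert x A" for y
    proof (cases "y = x")
      case True
      have "Poly_Mapping.single 0 (of_int (a * b)) * f y
        = Poly_Mapping.single 0 (of_int a) * (Poly_Mapping.single 0 (of_int b) * f x)"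
        unfolding const_of_int_mult True by (simp only: algebra_simps)
      also have "\<dots> = mpoly_of_int (Poly_Mapping.single 0 a * g)"
        unfolding b(2) by simp
      finally show ?thesis ..
    next
      case False
      then obtain h where h: "Poly_Mapping.single 0 (of_int a) * f y = mpoly_of_int h"
        using a y by auto
      have "Poly_Mapping.single 0 (of_int (a * b)) * f y
        = Poly_Mapping.single 0 (of_int b) * (Poly_Mapping.single 0 (of_int a) * f y)"
        unfolding const_of_int_mult by (simp only: algebra_simps)
      also have "\<dots> = mpoly_of_int (Poly_Mapping.single 0 b * h)"
        unfolding h by simp
      finally show ?thesis ..
    qed
    with a(1) b(1) show ?case by (meson mult_pos_pos)
  qed
  then show thesis using that by metis
qed


subsection \<open>Partial derivatives\<close>

lemma lookup_mpoly_partial: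
  "Poly_Mapping.lookup (mpoly_partial i f) k
    = of_nat (Poly_Mapping.lookup k i + 1) * Poly_Mapping.lookup f (k + Poly_Mapping.single i 1)"
proof -
  \<comment> \<open>Subtraction of exponents is truncated: if \<open>x_i\<close> does not occur in
    \<open>m\<close>, the exponent stays \<open>m\<close>, but then the coefficient is 0. Otherwise
    the shift by one is invertible.\<close>
  have eq: "Poly_Mapping.lookup (Poly_Mapping.single (m - Poly_Mapping.single i 1)
          (of_nat (Poly_Mapping.lookup m i) * Poly_Mapping.lookup f m)) k
      = (if m = k + Poly_Mapping.single i 1 then of_nat (Poly_Mapping.lookup m i) * Poly_Mapping.lookup f m else 0)" for m
  proof (cases "Poly_Mapping.lookup m i = 0")
    case True
    then show ?thesis by (auto simp: lookup_add)
  next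
    case False
    then have "m - Poly_Mapping.single i 1 + Poly_Mapping.single i 1 = m"
      by (intro poly_mapping_eqI) (auto simp: lookup_add lookup_minus lookup_single when_def)
    then have "m - Poly_Mapping.single i 1 = k \<longleftrightarrow> m = k + Poly_Mapping.single i 1"
      by (metis add_diff_cancel_right')
    then show ?thesis by (simp add: lookup_single when_def)
  qed
  show ?thesis
    unfolding mpoly_partial_def lookup_sum eq
    by (simp add: sum.delta lookup_add not_in_keys_iff_lookup_eq_zero)
qed

lemma mpoly_partial_add: "mpoly_partial i (f + g) = mpoly_partial i f + mpoly_partial i g"
  by (rule poly_mapping_eqI) (simp add: lookup_mpoly_partial lookup_add distrib_left)

lemma mpoly_partial_single:
  "mpoly_partial i (Poly_Mapping.single m c)
    = Poly_Mapping.single (m - Poly_Mapping.single i 1) (of_nat (Poly_Mapping.lookup m i) * c)"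
  unfolding mpoly_partial_def by (cases "c = 0") simp_all

lemma mpoly_partial_mult:
  fixes f g :: "('l::finite, 'a::comm_semiring_1) mpoly"
  shows "mpoly_partial i (f * g) = mpoly_partial i f * g + f * mpoly_partial i g"
proof (induction f rule: mpoly_induct)
  case (single a c)
  show ?case
  proof (induction g rule: mpoly_induct)
    case (single b d)
    let ?e = "Poly_Mapping.single i (1::nat)"
    have shift: "x + y - ?e = (x - ?e) + y" if "Poly_Mapping.lookup x i \<noteq> 0" for x y :: "'l \<Rightarrow>\<^sub>0 nat"
      using that by (intro poly_mapping_eqI) (auto simp: lookup_add lookup_minus lookup_single when_def)
    \<comment> \<open>The exponents themselves may differ when the subtraction truncates. Whole
      monomials are compared instead, since the coefficient vanishes in that case.\<close>
    have 1: "Poly_Mapping.single (a - ?e + b) (of_nat (Poly_Mapping.lookup a i) * c * d)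
      = Poly_Mapping.single (a + b - ?e) (of_nat (Poly_Mapping.lookup a i) * c * d)"
      using shift[of a b] by (cases "Poly_Mapping.lookup a i = 0") simp_all
    have 2: "Poly_Mapping.single (a + (b - ?e)) (c * (of_nat (Poly_Mapping.lookup b i) * d))
      = Poly_Mapping.single (a + b - ?e) (c * (of_nat (Poly_Mapping.lookup b i) * d))"
      using shift[of b a] by (cases "Poly_Mapping.lookup b i = 0") (simp_all add: ac_simps)
    show ?case
      unfolding mpoly_partial_single mult_single 1 2
      by (simp add: lookup_add algebra_simps flip: single_add)
  qed (simp add: mpoly_partial_add algebra_simps)
qed (simp add: mpoly_partial_add algebra_simps)

lemma mpoly_of_int_partial:
  "(mpoly_of_int (mpoly_partial i f) :: ('l::finite, 'a::comm_ring_1) mpoly) = mpoly_partial i (mpoly_of_int f)"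
  by (rule poly_mapping_eqI) (simp add: lookup_mpoly_partial)

lemma deriv_apply_mult:
  "deriv_apply \<delta> (f * g) = deriv_apply \<delta> f * g + f * deriv_apply \<delta> g"
  unfolding deriv_apply_def mpoly_partial_mult
  by (simp add: algebra_simps sum.distrib sum_distrib_left sum_distrib_right)

lemma mpoly_partial_const: "mpoly_partial i (Poly_Mapping.single 0 c) = 0"
  by (simp add: mpoly_partial_single)

lemma deriv_apply_const_mult:
  "deriv_apply \<delta> (Poly_Mapping.single 0 c * f) = Poly_Mapping.single 0 c * deriv_apply \<delta> f"
  unfolding deriv_apply_mult by (simp add: deriv_apply_def mpoly_partial_const)

lemma deriv_apply_add_left: "deriv_apply (\<delta> + \<epsilon>) f = deriv_apply \<delta> f + deriv_apply \<epsilon> f"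
  by (simp add: deriv_apply_def distrib_right sum.distrib)

lemma deriv_apply_smult: "deriv_apply (g *s \<delta>) f = g * deriv_apply \<delta> f"
  by (simp add: deriv_apply_def sum_distrib_left mult.assoc)

text \<open>One map for both targets: it is the reduction modulo \<open>p\<close> as well as the
  embedding into rational derivations, so an integral identity can be read on either side.\<close>

definition vec_of_int :: "('l, int) mpoly ^ 'l \<Rightarrow> ('l::finite, 'a::comm_ring_1) mpoly ^ 'l" where
  "vec_of_int \<theta> = (\<chi> i. mpoly_of_int (\<theta> $ i))"

lemma vec_of_int_nth [simp]: "vec_of_int \<theta> $ i = mpoly_of_int (\<theta> $ i)"
  by (simp add: vec_of_int_def)

lemma mpoly_of_int_deriv_apply:
  "mpoly_of_int (deriv_apply \<theta> f) = deriv_apply (vec_of_int \<theta>) (mpoly_of_int f)"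
  by (simp add: deriv_apply_def mpoly_of_int_partial)

lemma vec_of_int_add: "vec_of_int (\<theta> + \<eta>) = vec_of_int \<theta> + vec_of_int \<eta>"
  by (simp add: vec_eq_iff)

lemma vec_of_int_smult: "vec_of_int (f *s \<theta>) = mpoly_of_int f *s vec_of_int \<theta>"
  by (simp add: vec_eq_iff)

lemma vec_of_int_sum: "vec_of_int (\<Sum>x\<in>A. \<theta> x) = (\<Sum>x\<in>A. vec_of_int (\<theta> x))"
  by (simp add: vec_eq_iff)

subsection \<open>Homogeneous components\<close>

definition mdeg :: "('l::finite \<Rightarrow>\<^sub>0 nat) \<Rightarrow> nat" where
  "mdeg m = (\<Sum>i\<in>UNIV. Poly_Mapping.lookup m i)"

lemma mdeg_add: "mdeg (a + b) = mdeg a + mdeg b"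
  by (simp add: mdeg_def lookup_add sum.distrib)

lemma mdeg_single [simp]: "mdeg (Poly_Mapping.single i k) = k"
  by (simp add: mdeg_def lookup_single when_def)

lemma mdeg_eq_1_iff: "mdeg m = 1 \<longleftrightarrow> (\<exists>i. m = Poly_Mapping.single i 1)"
proof
  assume "mdeg m = 1"
  then obtain i where i: "Poly_Mapping.lookup m i = 1" "\<And>j. j \<noteq> i \<Longrightarrow> Poly_Mapping.lookup m j = 0"
    unfolding mdeg_def sum_eq_1_iff[OF finite] by (metis UNIV_I)
  then have "m = Poly_Mapping.single i 1"
    by (intro poly_mapping_eqI) (auto simp: lookup_single when_def)
  then show "\<exists>i. m = Poly_Mapping.single i 1" ..
qed auto

text \<open>Each exponent is bounded by the total degree. Besides making \<open>hcomp\<close> a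
  finite sum, this is the finiteness that bounds denominators in \<open>descent\<close>.\<close>

lemma finite_mdeg_eq: "finite {m :: 'l::finite \<Rightarrow>\<^sub>0 nat. mdeg m = d}"
proof (rule finite_imageD)
  have "Poly_Mapping.lookup m i \<le> mdeg m" for m :: "'l \<Rightarrow>\<^sub>0 nat" and i
    unfolding mdeg_def by (rule member_le_sum) auto
  then have "Poly_Mapping.lookup ` {m. mdeg m = d} \<subseteq> Pi\<^sub>E (UNIV :: 'l set) (\<lambda>_. {..d})"
    by auto
  then show "finite (Poly_Mapping.lookup ` {m :: 'l \<Rightarrow>\<^sub>0 nat. mdeg m = d})"
    by (rule finite_subset) (auto intro: finite_PiE)
qed (simp add: inj_on_def)

lemma homogeneous_iff: "homogeneous d f \<longleftrightarrow> (\<forall>m. Poly_Mapping.lookup f m \<noteq> 0 \<longrightarrow> mdeg m = d)"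
  by (auto simp: homogeneous_def mdeg_def in_keys_iff)

definition hcomp :: "nat \<Rightarrow> ('l::finite, 'a::comm_monoid_add) mpoly \<Rightarrow> ('l, 'a) mpoly" where
  "hcomp d f = (\<Sum>m\<in>{m. mdeg m = d}. Poly_Mapping.single m (Poly_Mapping.lookup f m))"

lemma lookup_hcomp: "Poly_Mapping.lookup (hcomp d f) m = (if mdeg m = d then Poly_Mapping.lookup f m else 0)"
  unfolding hcomp_def lookup_sum
  by (simp add: lookup_single when_def finite_mdeg_eq)

lemma homogeneous_hcomp: "homogeneous d (hcomp d f)"
  by (simp add: homogeneous_iff lookup_hcomp)

lemma hcomp_homogeneous: "homogeneous e f \<Longrightarrow> hcomp d f = (if d = e then f else 0)"
  by (rule poly_mapping_eqI) (auto simp: homogeneous_iff lookup_hcomp)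

lemma hcomp_eq_0: "d \<notin> mdeg ` Poly_Mapping.keys f \<Longrightarrow> hcomp d f = 0"
  by (rule poly_mapping_eqI) (auto simp: lookup_hcomp in_keys_iff)

lemma hcomp_add: "hcomp d (f + g) = hcomp d f + hcomp d g"
  by (rule poly_mapping_eqI) (simp add: lookup_hcomp lookup_add)

lemma hcomp_sum: "hcomp d (\<Sum>x\<in>A. f x) = (\<Sum>x\<in>A. hcomp d (f x))"
  by (rule poly_mapping_eqI) (simp add: lookup_hcomp lookup_sum)

lemma hcomp_const_mult:
  "hcomp d (Poly_Mapping.single 0 c * f) = Poly_Mapping.single 0 c * hcomp d f"
  by (rule poly_mapping_eqI) (simp add: lookup_hcomp lookup_const_mult)

lemma hcomp_mpoly_of_int: "hcomp d (mpoly_of_int f) = mpoly_of_int (hcomp d f)"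
  by (rule poly_mapping_eqI) (simp add: lookup_hcomp)

lemma sum_hcomp: "f = (\<Sum>d\<in>mdeg ` Poly_Mapping.keys f. hcomp d f)"
proof (rule poly_mapping_eqI)
  fix m
  show "Poly_Mapping.lookup f m = Poly_Mapping.lookup (\<Sum>d\<in>mdeg ` Poly_Mapping.keys f. hcomp d f) m"
    by (cases "m \<in> Poly_Mapping.keys f") (auto simp: lookup_sum lookup_hcomp in_keys_iff)
qed

lemma homogeneous_mult:
  fixes f g :: "('l::finite, 'a::semiring_0) mpoly"
  assumes "homogeneous a f" "homogeneous b g"
  shows "homogeneous (a + b) (f * g)"
  unfolding homogeneous_def mdeg_def[symmetric]
proof
  fix m assume "m \<in> Poly_Mapping.keys (f * g)"
  then obtain x y where "m = x + y" "x \<in> Poly_Mapping.keys f" "y \<in> Poly_Mapping.keys g"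
    using keys_mult[of f g] by auto
  with assms show "mdeg m = a + b"
    by (simp add: homogeneous_def mdeg_add flip: mdeg_def)
qed

text \<open>The case distinction guards the truncated \<open>d - a\<close>: below degree
  \<open>a\<close> the product has no terms.\<close>

lemma hcomp_mult:
  fixes f g :: "('l::finite, 'a::comm_semiring_0) mpoly"
  assumes "homogeneous a f"
  shows "hcomp d (f * g) = (if a \<le> d then f * hcomp (d - a) g else 0)"
proof -
  let ?E = "mdeg ` Poly_Mapping.keys g"
  have "hcomp d (f * g) = hcomp d (f * (\<Sum>e\<in>?E. hcomp e g))"
    by (simp flip: sum_hcomp)
  also have "\<dots> = (\<Sum>e\<in>?E. if d = a + e then f * hcomp e g else 0)"
    unfolding sum_distrib_left hcomp_sum
    by (intro sum.cong refl hcomp_homogeneous homogeneous_mult assms homogeneous_hcomp)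
  also have "\<dots> = (\<Sum>e\<in>?E. if e = d - a then (if a \<le> d then f * hcomp (d - a) g else 0) else 0)"
    by (intro sum.cong) auto
  also have "\<dots> = (if a \<le> d then f * hcomp (d - a) g else 0)"
    using hcomp_eq_0[of "d - a" g] by (auto simp: sum.delta)
  finally show ?thesis .
qed


subsection \<open>Linear forms\<close>

definition lcoeff :: "('l, 'a::zero) mpoly \<Rightarrow> 'l \<Rightarrow> 'a" where
  "lcoeff f i = Poly_Mapping.lookup f (Poly_Mapping.single i 1)"

lemma inj_single_exponent: "inj (\<lambda>i. Poly_Mapping.single i (1::nat))"
  by (rule injI) (metis lookup_single_eq lookup_single_not_eq zero_neq_one)

lemma linear_form_expand:
  fixes f :: "('l::finite, 'a::comm_monoid_add) mpoly"
  assumes "homogeneous 1 f"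
  shows "f = (\<Sum>i\<in>UNIV. Poly_Mapping.single (Poly_Mapping.single i 1) (lcoeff f i))"
proof -
  have "f = hcomp 1 f"
    using hcomp_homogeneous[OF assms, of 1] by simp
  also have "\<dots> = (\<Sum>m\<in>range (\<lambda>i. Poly_Mapping.single i 1). Poly_Mapping.single m (Poly_Mapping.lookup f m))"
    unfolding hcomp_def mdeg_eq_1_iff full_SetCompr_eq ..
  also have "\<dots> = (\<Sum>i\<in>UNIV. Poly_Mapping.single (Poly_Mapping.single i 1) (lcoeff f i))"
    unfolding sum.reindex[OF inj_single_exponent] lcoeff_def o_def ..
  finally show ?thesis .
qed

lemma linear_form_eqI:
  fixes f g :: "('l::finite, 'a::comm_monoid_add) mpoly"
  assumes "homogeneous 1 f" "homogeneous 1 g" "\<And>i. lcoeff f i = lcoeff g i"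
  shows "f = g"
proof -
  note linear_form_expand[OF assms(1)]
  also have "(\<Sum>i\<in>UNIV. Poly_Mapping.single (Poly_Mapping.single i 1) (lcoeff f i))
      = (\<Sum>i\<in>UNIV. Poly_Mapping.single (Poly_Mapping.single i 1) (lcoeff g i))"
    by (simp add: assms(3))
  also note linear_form_expand[OF assms(2), symmetric]
  finally show ?thesis .
qed

lemma linear_form_nonzero_coeff:
  fixes f :: "('l::finite, 'a::comm_monoid_add) mpoly"
  assumes "homogeneous 1 f" "f \<noteq> 0"
  obtains k where "lcoeff f k \<noteq> 0"
proof -
  have "homogeneous 1 (0 :: ('l, 'a) mpoly)" "\<And>i. lcoeff (0 :: ('l, 'a) mpoly) i = 0"
    by (simp_all add: homogeneous_def lcoeff_def)
  then show thesis using linear_form_eqI[OF assms(1)] assms(2) that by metis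
qed

lemma lcoeff_const_mult [simp]:
  fixes f :: "('l, 'a::semiring_0) mpoly"
  shows "lcoeff (Poly_Mapping.single 0 c * f) i = c * lcoeff f i"
  by (simp add: lcoeff_def lookup_const_mult)

lemma homogeneous_const_mult:
  fixes f :: "('l::finite, 'a::semiring_0) mpoly"
  assumes "homogeneous d f"
  shows "homogeneous d (Poly_Mapping.single 0 c * f)"
  unfolding homogeneous_iff lookup_const_mult
proof (intro allI impI)
  fix m assume "c * Poly_Mapping.lookup f m \<noteq> 0"
  then have "Poly_Mapping.lookup f m \<noteq> 0" by auto
  with assms show "mdeg m = d" by (simp add: homogeneous_iff)
qed

lemma homogeneous_diff:
  fixes f g :: "('l::finite, 'a::ab_group_add) mpoly"
  assumes "homogeneous d f" "homogeneous d g"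
  shows "homogeneous d (f - g)"
  unfolding homogeneous_iff lookup_minus
proof (intro allI impI)
  fix m assume "Poly_Mapping.lookup f m - Poly_Mapping.lookup g m \<noteq> 0"
  then have "Poly_Mapping.lookup f m \<noteq> 0 \<or> Poly_Mapping.lookup g m \<noteq> 0" by auto
  with assms show "mdeg m = d" by (auto simp: homogeneous_iff)
qed

section \<open>Linear forms and their zero loci\<close>

lemma mpoly_eval_linear_form:
  fixes f :: "('l::finite, 'a::comm_semiring_1) mpoly"
  assumes "homogeneous 1 f"
  shows "mpoly_eval f v = (\<Sum>i\<in>UNIV. lcoeff f i * v $ i)"
proof -
  let ?e = "\<lambda>i::'l. Poly_Mapping.single i (1::nat)"
  have "Poly_Mapping.keys f \<subseteq> range ?e"
    using assms mdeg_eq_1_iff[where 'a = 'l] by (auto simp: homogeneous_iff in_keys_iff)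
  then have "mpoly_eval f v = (\<Sum>m\<in>range ?e. Poly_Mapping.lookup f m * (\<Prod>i\<in>UNIV. (v $ i) ^ Poly_Mapping.lookup m i))"
    unfolding mpoly_eval_def by (intro sum.mono_neutral_left) (auto simp: in_keys_iff)
  also have "\<dots> = (\<Sum>i\<in>UNIV. lcoeff f i * v $ i)"
  proof -
    have "(\<Prod>j\<in>UNIV. (v $ j) ^ Poly_Mapping.lookup (?e i) j) = v $ i" for i
    proof -
      have "(\<Prod>j\<in>UNIV. (v $ j) ^ Poly_Mapping.lookup (?e i) j) = (\<Prod>j\<in>UNIV. if j = i then v $ i else 1)"
        by (intro prod.cong) (auto simp: lookup_single when_def)
      then show ?thesis by simp
    qed
    then show ?thesis unfolding sum.reindex[OF inj_single_exponent] lcoeff_def o_def by simp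
  qed
  finally show ?thesis .
qed

lemma zero_locus_eq_imp_proportional:
  fixes f g :: "('l::finite, 'a::field) mpoly"
  assumes f: "homogeneous 1 f" "f \<noteq> 0" and g: "homogeneous 1 g" "g \<noteq> 0"
    and eq: "zero_locus f = zero_locus g"
  obtains c where "g = Poly_Mapping.single 0 c * f"
proof -
  obtain k where k: "lcoeff f k \<noteq> 0"
    using linear_form_nonzero_coeff[OF f] .
  have coeffs: "lcoeff g j = lcoeff g k / lcoeff f k * lcoeff f j" for j
  proof (cases "j = k")
    case False
    \<comment> \<open>The vector \<open>f_k e_j - f_j e_k\<close> is a zero of \<open>f\<close>; a
      form \<open>h\<close> takes on it the 2x2 minor of the coefficients of \<open>h\<close> and
      \<open>f\<close> at \<open>j\<close> and \<open>k\<close>. For \<open>g\<close> this minor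
      must vanish.\<close>
    define v :: "'a ^ 'l" where
      "v = (\<chi> i. if i = j then lcoeff f k else if i = k then - lcoeff f j else 0)"
    have ev: "mpoly_eval h v = lcoeff h j * lcoeff f k - lcoeff h k * lcoeff f j"
      if "homogeneous 1 h" for h
    proof -
      have "mpoly_eval h v = (\<Sum>i\<in>UNIV. (if i = j then lcoeff h j * lcoeff f k else 0)
          + (if i = k then - (lcoeff h k * lcoeff f j) else 0))"
        unfolding mpoly_eval_linear_form[OF that]
        by (intro sum.cong) (use False in \<open>auto simp: v_def\<close>)
      then show ?thesis by (simp add: sum.distrib)
    qed
    have "v \<in> zero_locus f"
      using ev[OF f(1)] by (simp add: zero_locus_def)
    then have "v \<in> zero_locus g" by (simp add: eq)
    then show ?thesis
      using ev[OF g(1)] k by (simp add: zero_locus_def field_simps)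
  qed (use k in simp)
  have "g = Poly_Mapping.single 0 (lcoeff g k / lcoeff f k) * f"
    by (rule linear_form_eqI[OF g(1) homogeneous_const_mult[OF f(1)]], subst lcoeff_const_mult)
      (rule coeffs)
  then show thesis by (rule that)
qed

lemma zero_locus_const_mult:
  fixes f :: "('l::finite, 'a::field) mpoly"
  assumes "homogeneous 1 f" "c \<noteq> 0"
  shows "zero_locus (Poly_Mapping.single 0 c * f) = zero_locus f"
proof -
  have "mpoly_eval (Poly_Mapping.single 0 c * f) v = c * mpoly_eval f v" for v
    unfolding mpoly_eval_linear_form[OF assms(1)]
      mpoly_eval_linear_form[OF homogeneous_const_mult[OF assms(1)]] lcoeff_const_mult
    by (simp only: sum_distrib_left mult.assoc)
  then have "mpoly_eval (Poly_Mapping.single 0 c * f) v = 0 \<longleftrightarrow> mpoly_eval f v = 0" for v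
    by (metis assms(2) mult_eq_0_iff)
  then show ?thesis unfolding zero_locus_def by (rule Collect_cong)
qed

text \<open>A leading-term argument in the single variable \<open>x_k\<close>: a term
  \<open>x_i\<close> of \<open>f\<close> with \<open>i \<noteq> k\<close> could reach this exponent
  only from a monomial of \<open>q\<close> whose \<open>x_k\<close>-exponent exceeds that of
  \<open>m\<close>.\<close>

lemma lookup_linear_form_mult:
  fixes f q :: "('l::finite, 'a::comm_semiring_1) mpoly"
  assumes f: "homogeneous 1 f"
    and max: "\<And>x. x \<in> Poly_Mapping.keys q \<Longrightarrow> Poly_Mapping.lookup x k \<le> Poly_Mapping.lookup m k"
  shows "Poly_Mapping.lookup (f * q) (Poly_Mapping.single k 1 + m) = lcoeff f k * Poly_Mapping.lookup q m"
proof -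
  let ?e = "\<lambda>i. Poly_Mapping.single i (1::nat)"
  have "Poly_Mapping.lookup (Poly_Mapping.single (?e i) (lcoeff f i) * q) (?e k + m) = 0" if "i \<noteq> k" for i
  proof (rule ccontr)
    assume "\<not> ?thesis"
    then have "?e k + m \<in> Poly_Mapping.keys (Poly_Mapping.single (?e i) (lcoeff f i) * q)"
      by (simp add: in_keys_iff)
    then obtain x where x: "x \<in> Poly_Mapping.keys q" "?e k + m = ?e i + x"
      using keys_mult[of "Poly_Mapping.single (?e i) (lcoeff f i)" q] by (auto split: if_splits)
    from x(2) have "Poly_Mapping.lookup (?e k + m) k = Poly_Mapping.lookup (?e i + x) k" by simp
    with max[OF x(1)] that show False
      by (simp add: lookup_add lookup_single)
  qed
  then have "(\<Sum>i\<in>UNIV. if i = k then lcoeff f k * Poly_Mapping.lookup q m else 0)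
    = (\<Sum>i\<in>UNIV. Poly_Mapping.lookup (Poly_Mapping.single (?e i) (lcoeff f i) * q) (?e k + m))"
    by (intro sum.cong) (auto simp: lookup_single_mult_shift)
  also have "(\<Sum>i\<in>UNIV. Poly_Mapping.lookup (Poly_Mapping.single (?e i) (lcoeff f i) * q) (?e k + m))
    = Poly_Mapping.lookup (f * q) (?e k + m)"
    unfolding lookup_sum[symmetric] sum_distrib_right[symmetric] linear_form_expand[OF f, symmetric] ..
  finally show ?thesis by simp
qed

lemma exists_max_exponent:
  fixes q :: "('l, 'a::zero) mpoly"
  assumes "q \<noteq> 0"
  obtains m where "m \<in> Poly_Mapping.keys q"
    "\<And>x. x \<in> Poly_Mapping.keys q \<Longrightarrow> Poly_Mapping.lookup x k \<le> Poly_Mapping.lookup m k"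
proof -
  let ?g = "\<lambda>x. Poly_Mapping.lookup x k"
  have ne: "Poly_Mapping.keys q \<noteq> {}" using assms by simp
  then have "Max (?g ` Poly_Mapping.keys q) \<in> ?g ` Poly_Mapping.keys q"
    by (intro Max_in) auto
  then obtain m where "m \<in> Poly_Mapping.keys q" "?g m = Max (?g ` Poly_Mapping.keys q)"
    by auto
  then show thesis using that by simp
qed

lemma linear_form_mult_eq_0:
  fixes f q :: "('l::finite, 'a::idom) mpoly"
  assumes f: "homogeneous 1 f" "f \<noteq> 0" and "f * q = 0"
  shows "q = 0"
proof (rule ccontr)
  assume "q \<noteq> 0"
  obtain k where k: "lcoeff f k \<noteq> 0" using linear_form_nonzero_coeff[OF f] .
  obtain m where m: "m \<in> Poly_Mapping.keys q"
    "\<And>x. x \<in> Poly_Mapping.keys q \<Longrightarrow> Poly_Mapping.lookup x k \<le> Poly_Mapping.lookup m k"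
    using exists_max_exponent[OF \<open>q \<noteq> 0\<close>] by blast
  from lookup_linear_form_mult[where q = q, OF f(1) m(2)] have "lcoeff f k * Poly_Mapping.lookup q m = 0"
    by (simp add: \<open>f * q = 0\<close>)
  with k m(1) show False by (simp add: in_keys_iff)
qed

text \<open>Polynomials not involving \<open>x_k\<close>: the remainders on division by a linear
  form whose \<open>k\<close>-th coefficient is nonzero.\<close>

definition indep_of :: "'l \<Rightarrow> ('l, 'a::zero) mpoly \<Rightarrow> bool" where
  "indep_of k f \<longleftrightarrow> (\<forall>m\<in>Poly_Mapping.keys f. Poly_Mapping.lookup m k = 0)"

lemma indep_of_add:
  fixes f g :: "('l, 'a::comm_monoid_add) mpoly"
  shows "indep_of k f \<Longrightarrow> indep_of k g \<Longrightarrow> indep_of k (f + g)"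
  using keys_add[of f g] by (auto simp: indep_of_def)

lemma indep_of_mult:
  fixes f g :: "('l, 'a::semiring_0) mpoly"
  shows "indep_of k f \<Longrightarrow> indep_of k g \<Longrightarrow> indep_of k (f * g)"
  using keys_mult[of f g] by (fastforce simp: indep_of_def lookup_add)

lemma linear_form_indep_of:
  assumes "homogeneous 1 f" "lcoeff f k = 0"
  shows "indep_of k f"
  unfolding indep_of_def
proof
  fix m assume m: "m \<in> Poly_Mapping.keys f"
  then obtain i where i: "m = Poly_Mapping.single i 1"
    using assms(1) mdeg_eq_1_iff by (auto simp: homogeneous_iff in_keys_iff)
  with m assms(2) have "i \<noteq> k" by (auto simp: lcoeff_def in_keys_iff)
  with i show "Poly_Mapping.lookup m k = 0" by (simp add: lookup_single)
qed

text \<open>Modulo \<open>\<beta>\<close> the variable \<open>x_k\<close> is congruent to a form in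
  the other variables; the factors \<open>x_k\<close> of a monomial are replaced one at a
  time.\<close>

lemma linear_form_division:
  fixes \<beta> f :: "('l::finite, 'a::field) mpoly"
  assumes \<beta>: "homogeneous 1 \<beta>" and k: "lcoeff \<beta> k \<noteq> 0"
  shows "\<exists>q r. f = \<beta> * q + r \<and> indep_of k r"
proof (induction f rule: mpoly_induct)
  case (single m c)
  let ?x = "Poly_Mapping.single (Poly_Mapping.single k 1) 1 :: ('l, 'a) mpoly"
  let ?b = "Poly_Mapping.single 0 (inverse (lcoeff \<beta> k)) :: ('l, 'a) mpoly"
  \<comment> \<open>The scalar in \<open>?b\<close> cancels the \<open>x_k\<close>-coefficient, so
    \<open>\<gamma>\<close> is the substitute for \<open>x_k\<close> modulo
    \<open>\<beta>\<close>.\<close>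
  define \<gamma> where "\<gamma> = ?x - ?b * \<beta>"
  have x: "homogeneous 1 ?x"
    by (simp add: homogeneous_iff lookup_single when_def)
  have \<gamma>: "indep_of k \<gamma>"
    unfolding \<gamma>_def
    by (intro linear_form_indep_of homogeneous_diff homogeneous_const_mult \<beta> x)
      (use k in \<open>simp add: lcoeff_def lookup_minus lookup_const_mult\<close>)
  show ?case
  proof (induction "Poly_Mapping.lookup m k" arbitrary: m)
    case 0
    then have "indep_of k (Poly_Mapping.single m c)" by (simp add: indep_of_def)
    then have "Poly_Mapping.single m c = \<beta> * 0 + Poly_Mapping.single m c \<and> indep_of k (Poly_Mapping.single m c)"
      by simp
    then show ?case by blast
  next
    case (Suc j)
    define m' where "m' = m - Poly_Mapping.single k 1"
    have m: "m = Poly_Mapping.single k 1 + m'"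
      using Suc.hyps(2) unfolding m'_def
      by (intro poly_mapping_eqI) (auto simp: lookup_add lookup_minus lookup_single when_def)
    with Suc.hyps(2) have "j = Poly_Mapping.lookup m' k"
      by (simp add: lookup_add)
    from Suc.hyps(1)[OF this] obtain q r where qr: "Poly_Mapping.single m' c = \<beta> * q + r" "indep_of k r"
      by blast
    \<comment> \<open>On expanding, every term except \<open>\<gamma> * r\<close> contains
      \<open>\<beta>\<close>, and \<open>\<gamma> * r\<close> is again free of
      \<open>x_k\<close>.\<close>
    have "Poly_Mapping.single m c = (\<gamma> + ?b * \<beta>) * Poly_Mapping.single m' c"
      by (simp add: \<gamma>_def m mult_single)
    also have "\<dots> = \<beta> * ((\<gamma> + ?b * \<beta>) * q + ?b * r) + \<gamma> * r"
      unfolding qr by (simp only: algebra_simps)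
    finally show ?case using indep_of_mult[OF \<gamma> qr(2)] by blast
  qed
next
  case (add f g)
  then obtain q r q' r' where "f = \<beta> * q + r" "indep_of k r" "g = \<beta> * q' + r'" "indep_of k r'"
    by blast
  then have "f + g = \<beta> * (q + q') + (r + r')" "indep_of k (r + r')"
    by (simp_all add: algebra_simps indep_of_add)
  then show ?case by blast
qed

text \<open>The top \<open>x_k\<close>-exponent of a nonzero multiple of \<open>\<beta>\<close> is
  at least 1, so 0 is the only remainder divisible by \<open>\<beta>\<close>.\<close>

lemma linear_form_dvd_indep_of:
  fixes \<beta> q :: "('l::finite, 'a::idom) mpoly"
  assumes "homogeneous 1 \<beta>" "lcoeff \<beta> k \<noteq> 0" "indep_of k (\<beta> * q)"
  shows "\<beta> * q = 0"
proof (rule ccontr)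
  assume "\<beta> * q \<noteq> 0"
  then have "q \<noteq> 0" by auto
  then obtain m where m: "m \<in> Poly_Mapping.keys q"
    "\<And>x. x \<in> Poly_Mapping.keys q \<Longrightarrow> Poly_Mapping.lookup x k \<le> Poly_Mapping.lookup m k"
    using exists_max_exponent[OF \<open>q \<noteq> 0\<close>] by blast
  have "Poly_Mapping.single k 1 + m \<in> Poly_Mapping.keys (\<beta> * q)"
    using lookup_linear_form_mult[where q = q, OF assms(1) m(2)] assms(2) m(1) by (simp add: in_keys_iff)
  with assms(3) show False by (fastforce simp: indep_of_def lookup_add)
qed

text \<open>
  A nonzero linear form over a field is prime, since modulo it one of the variables can be
  eliminated; only the case of a product with another linear form is needed.
\<close>

lemma linear_forms_coprime:
  fixes \<beta> \<gamma> f :: "('l::finite, 'a::field) mpoly"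
  assumes \<beta>: "homogeneous 1 \<beta>" "\<beta> \<noteq> 0" and \<gamma>: "homogeneous 1 \<gamma>"
    and nprop: "\<And>c. \<gamma> \<noteq> Poly_Mapping.single 0 c * \<beta>"
    and dvd: "\<beta> dvd \<gamma> * f"
  shows "\<beta> dvd f"
proof -
  obtain k where k: "lcoeff \<beta> k \<noteq> 0" using linear_form_nonzero_coeff[OF \<beta>] .
  \<comment> \<open>Subtracting \<open>C\<close> removes \<open>x_k\<close> from
    \<open>\<gamma>\<close> without changing it modulo \<open>\<beta>\<close>; the result is nonzero
    because the forms are not proportional.\<close>
  define C where "C = Poly_Mapping.single 0 (lcoeff \<gamma> k / lcoeff \<beta> k) * \<beta>"
  define \<gamma>' where "\<gamma>' = \<gamma> - C"
  have "homogeneous 1 C"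
    unfolding C_def by (rule homogeneous_const_mult[OF \<beta>(1)])
  then have \<gamma>': "homogeneous 1 \<gamma>'" "\<gamma>' \<noteq> 0"
    using nprop by (simp_all add: \<gamma>'_def C_def homogeneous_diff \<gamma> del: One_nat_def)
  have "lcoeff \<gamma>' k = lcoeff \<gamma> k - lcoeff C k"
    by (simp add: \<gamma>'_def lcoeff_def lookup_minus)
  then have ind: "indep_of k \<gamma>'"
    using k by (intro linear_form_indep_of \<gamma>') (simp add: C_def)
  obtain q r where qr: "f = \<beta> * q + r" "indep_of k r"
    using linear_form_division[OF \<beta>(1) k] by blast
  have "\<beta> dvd C" by (simp add: C_def)
  have "\<beta> dvd \<gamma> * f - C * f"
    by (rule dvd_diff[OF dvd dvd_mult2[OF \<open>\<beta> dvd C\<close>]])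
  then have "\<beta> dvd \<gamma>' * f - \<gamma>' * (\<beta> * q)"
    unfolding \<gamma>'_def left_diff_distrib[of \<gamma> C f] by (rule dvd_diff) simp_all
  moreover have "\<gamma>' * f - \<gamma>' * (\<beta> * q) = \<gamma>' * r"
    unfolding qr(1) distrib_left by simp
  ultimately have "\<beta> dvd \<gamma>' * r" by simp
  then have "\<gamma>' * r = 0"
    using linear_form_dvd_indep_of[OF \<beta>(1) k] indep_of_mult[OF ind qr(2)] by (metis dvdE)
  then have "r = 0" by (rule linear_form_mult_eq_0[OF \<gamma>'])
  then show ?thesis by (simp add: qr)
qed

subsection \<open>Logarithmic derivations\<close>

lemma mpoly_partial_linear_form:
  fixes f :: "('l::finite, 'a::comm_semiring_1) mpoly"
  assumes "homogeneous 1 f"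
  shows "mpoly_partial i f = Poly_Mapping.single 0 (lcoeff f i)"
proof (rule poly_mapping_eqI)
  fix k
  show "Poly_Mapping.lookup (mpoly_partial i f) k = Poly_Mapping.lookup (Poly_Mapping.single 0 (lcoeff f i)) k"
  proof (cases "k = 0")
    case False
    then have "mdeg k \<noteq> 0"
      by (metis mdeg_def UNIV_I finite lookup_zero poly_mapping_eqI sum_eq_0_iff)
    then have "Poly_Mapping.lookup f (k + Poly_Mapping.single i 1) = 0"
      using assms unfolding homogeneous_iff by (metis mdeg_add mdeg_single add_eq_self_zero add.commute)
    with False show ?thesis
      unfolding lookup_mpoly_partial by (simp add: lookup_single)
  qed (simp add: lookup_mpoly_partial lcoeff_def)
qed

section \<open>Graded components of derivations\<close>

definition vhcomp :: "nat \<Rightarrow> ('l::finite, 'a::comm_monoid_add) mpoly ^ 'l \<Rightarrow> ('l, 'a) mpoly ^ 'l" where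
  "vhcomp d \<delta> = (\<chi> i. hcomp d (\<delta> $ i))"

lemma vhcomp_nth [simp]: "vhcomp d \<delta> $ i = hcomp d (\<delta> $ i)"
  by (simp add: vhcomp_def)

lemma has_pdeg_vhcomp: "has_pdeg (vhcomp d \<delta>) d"
  by (simp add: has_pdeg_def homogeneous_hcomp)

lemma vhcomp_has_pdeg: "has_pdeg \<delta> d \<Longrightarrow> vhcomp d \<delta> = \<delta>"
  using hcomp_homogeneous[where d = d and e = d] by (auto simp: vec_eq_iff has_pdeg_def)

lemma vhcomp_add: "vhcomp d (\<delta> + \<epsilon>) = vhcomp d \<delta> + vhcomp d \<epsilon>"
  by (simp add: vec_eq_iff hcomp_add)

lemma vhcomp_sum: "vhcomp d (\<Sum>x\<in>A. \<delta> x) = (\<Sum>x\<in>A. vhcomp d (\<delta> x))"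
  by (simp add: vec_eq_iff hcomp_sum)

lemma vhcomp_const_smult:
  "vhcomp d (Poly_Mapping.single 0 c *s \<delta>) = Poly_Mapping.single 0 c *s vhcomp d \<delta>"
  by (simp add: vec_eq_iff hcomp_const_mult)

lemma vhcomp_vec_of_int: "vhcomp d (vec_of_int \<theta>) = vec_of_int (vhcomp d \<theta>)"
  by (simp add: vec_eq_iff hcomp_mpoly_of_int)

lemma vhcomp_smult:
  fixes \<delta> :: "('l::finite, 'a::comm_ring_1) mpoly ^ 'l"
  assumes "has_pdeg \<delta> e"
  shows "vhcomp d (f *s \<delta>) = (if e \<le> d then hcomp (d - e) f else 0) *s \<delta>"
proof -
  have "hcomp d (f * \<delta> $ i) = (if e \<le> d then hcomp (d - e) f else 0) * \<delta> $ i" for i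
    using hcomp_mult[of e "\<delta> $ i" d f] assms by (simp add: has_pdeg_def mult.commute)
  then show ?thesis by (simp add: vec_eq_iff)
qed

text \<open>The partial derivatives of a linear form are constants, so the value of a derivation on
  it is a scalar combination of the entries and keeps their degree. Together with
  \<open>dvd_hcomp\<close> this makes D(A) graded.\<close>

lemma hcomp_deriv_apply_linear_form:
  fixes \<delta> :: "('l::finite, 'a::comm_semiring_1) mpoly ^ 'l"
  assumes "homogeneous 1 f"
  shows "hcomp d (deriv_apply \<delta> f) = deriv_apply (vhcomp d \<delta>) f"
  unfolding deriv_apply_def mpoly_partial_linear_form[OF assms] hcomp_sum vhcomp_nth
  by (simp only: mult.commute[of _ "Poly_Mapping.single 0 _"] hcomp_const_mult)

lemma dvd_hcomp:
  fixes f g :: "('l::finite, 'a::comm_semiring_1) mpoly"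
  assumes "homogeneous a f" "f dvd g"
  shows "f dvd hcomp d g"
proof -
  obtain h where "g = f * h" using assms(2) by (rule dvdE)
  then show ?thesis by (simp add: hcomp_mult[OF assms(1)])
qed

lemma sum_vhcomp:
  "\<delta> = (\<Sum>d\<in>(\<Union>i. mdeg ` Poly_Mapping.keys (\<delta> $ i)). vhcomp d \<delta>)"
proof -
  have "\<delta> $ i = (\<Sum>d\<in>(\<Union>i. mdeg ` Poly_Mapping.keys (\<delta> $ i)). hcomp d (\<delta> $ i))" for i
  proof -
    have "\<delta> $ i = (\<Sum>d\<in>mdeg ` Poly_Mapping.keys (\<delta> $ i). hcomp d (\<delta> $ i))"
      by (rule sum_hcomp)
    also have "\<dots> = (\<Sum>d\<in>(\<Union>i. mdeg ` Poly_Mapping.keys (\<delta> $ i)). hcomp d (\<delta> $ i))"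
    proof (rule sum.mono_neutral_left)
      show "\<forall>d\<in>(\<Union>i. mdeg ` Poly_Mapping.keys (\<delta> $ i)) - mdeg ` Poly_Mapping.keys (\<delta> $ i). hcomp d (\<delta> $ i) = 0"
        by (simp add: hcomp_eq_0)
    qed auto
    finally show ?thesis .
  qed
  then show ?thesis unfolding vec_eq_iff sum_component vhcomp_nth by blast
qed

text \<open>Two defining forms of one hyperplane differ by a constant, which derivations commute
  with; hence testing one chosen form per hyperplane suffices.\<close>

lemma log_derivations_iff:
  fixes a :: "'b \<Rightarrow> ('l::finite, 'a::field) mpoly"
  assumes a: "\<And>i. i \<in> I \<Longrightarrow> homogeneous 1 (a i)" "\<And>i. i \<in> I \<Longrightarrow> a i \<noteq> 0"
  shows "\<delta> \<in> log_derivations ((\<lambda>i. zero_locus (a i)) ` I) \<longleftrightarrow> (\<forall>i\<in>I. a i dvd deriv_apply \<delta> (a i))"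
proof (intro iffI ballI)
  fix i assume "\<delta> \<in> log_derivations ((\<lambda>i. zero_locus (a i)) ` I)" "i \<in> I"
  moreover have "defining_form (a i) (zero_locus (a i))"
    using a[OF \<open>i \<in> I\<close>] by (simp add: defining_form_def)
  ultimately show "a i dvd deriv_apply \<delta> (a i)"
    unfolding log_derivations_def by blast
next
  assume *: "\<forall>i\<in>I. a i dvd deriv_apply \<delta> (a i)"
  show "\<delta> \<in> log_derivations ((\<lambda>i. zero_locus (a i)) ` I)"
    unfolding log_derivations_def
  proof (intro CollectI ballI allI impI)
    fix K \<beta> assume "K \<in> (\<lambda>i. zero_locus (a i)) ` I" "defining_form \<beta> K"
    then obtain i where i: "i \<in> I" "zero_locus (a i) = zero_locus \<beta>" and \<beta>: "homogeneous 1 \<beta>" "\<beta> \<noteq> 0"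
      by (auto simp: defining_form_def)
    obtain c where c: "\<beta> = Poly_Mapping.single 0 c * a i"
      using zero_locus_eq_imp_proportional[OF a[OF i(1)] \<beta> i(2)] .
    then have "c \<noteq> 0" using \<beta>(2) by auto
    obtain h where "deriv_apply \<delta> (a i) = a i * h"
      using * i(1) by (metis dvdE)
    then have "deriv_apply \<delta> \<beta> = \<beta> * h"
      unfolding c deriv_apply_const_mult by (simp only: mult.assoc)
    then show "\<beta> dvd deriv_apply \<delta> \<beta>" by simp
  qed
qed

text \<open>Leibniz rule, factor by factor; this is the passage from the forms to \<open>Q\<close>,
  applied modulo \<open>p\<close>.\<close>

lemma prod_dvd_deriv_apply:
  fixes a :: "'b \<Rightarrow> ('l::finite, 'a::comm_ring_1) mpoly"
  assumes "finite I" "\<And>i. i \<in> I \<Longrightarrow> a i dvd deriv_apply \<delta> (a i)"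
  shows "(\<Prod>i\<in>I. a i) dvd deriv_apply \<delta> (\<Prod>i\<in>I. a i)"
  using assms
proof (induction I rule: finite_induct)
  case (insert x I)
  then show ?case
    unfolding prod.insert[OF insert.hyps] deriv_apply_mult
    by (intro dvd_add mult_dvd_mono) auto
qed simp

text \<open>With \<open>P\<close> the product of the other forms, the Leibniz rule leaves
  \<open>a j\<close> dividing \<open>P\<close> times \<open>deriv_apply \<delta> (a j)\<close>. The
  factors of \<open>P\<close> are cancelled one at a time, each being non-proportional to
  \<open>a j\<close>.\<close>

lemma dvd_deriv_apply_factor:
  fixes a :: "'b \<Rightarrow> ('l::finite, 'a::field) mpoly"
  assumes "finite I"
    and a: "\<And>i. i \<in> I \<Longrightarrow> homogeneous 1 (a i)" "\<And>i. i \<in> I \<Longrightarrow> a i \<noteq> 0"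
    and nprop: "\<And>i j c. i \<in> I \<Longrightarrow> j \<in> I \<Longrightarrow> i \<noteq> j \<Longrightarrow> a i \<noteq> Poly_Mapping.single 0 c * a j"
    and dvd: "(\<Prod>i\<in>I. a i) dvd deriv_apply \<delta> (\<Prod>i\<in>I. a i)"
    and j: "j \<in> I"
  shows "a j dvd deriv_apply \<delta> (a j)"
proof -
  have cancel: "a j dvd g" if "finite J" "J \<subseteq> I - {j}" "a j dvd (\<Prod>i\<in>J. a i) * g" for J g
    using that
  proof (induction J rule: finite_induct)
    case (insert x J)
    have "a j dvd a x * ((\<Prod>i\<in>J. a i) * g)"
      using insert.prems(2) unfolding prod.insert[OF insert.hyps] by (simp only: mult.assoc)
    moreover have x: "x \<in> I" "x \<noteq> j" using insert.prems(1) by auto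
    ultimately have "a j dvd (\<Prod>i\<in>J. a i) * g"
      using linear_forms_coprime[OF a(1)[OF j] a(2)[OF j] a(1)[OF x(1)] nprop[OF x(1) j x(2)]]
      by blast
    with insert show ?case by blast
  qed simp
  let ?P = "\<Prod>i\<in>I - {j}. a i"
  have eq: "(\<Prod>i\<in>I. a i) = a j * ?P"
    by (rule prod.remove[OF \<open>finite I\<close> j])
  have "a j dvd deriv_apply \<delta> (a j) * ?P + a j * deriv_apply \<delta> ?P"
    using dvd unfolding eq deriv_apply_mult by (rule dvd_mult_left)
  then have "a j dvd ?P * deriv_apply \<delta> (a j)"
    by (simp add: mult.commute dvd_add_left_iff)
  then show ?thesis
    by (rule cancel[OF finite_Diff[OF \<open>finite I\<close>] subset_refl])
qed

lemma subspace_log_derivations: "vec_mod.subspace (log_derivations B)"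
  unfolding vec_mod.subspace_def log_derivations_def
  by (auto simp: deriv_apply_add_left deriv_apply_smult) (simp add: deriv_apply_def)


subsection \<open>Divisibility by a prime number\<close>

lemma lookup_of_nat_mult:
  fixes f :: "('l, 'a::comm_ring_1) mpoly"
  shows "Poly_Mapping.lookup (of_nat p * f) m = of_nat p * Poly_Mapping.lookup f m"
  using lookup_const_mult[of "of_nat p" f m] by simp

lemma of_nat_mult_cancel:
  fixes f g :: "('l, int) mpoly"
  assumes "of_nat p * f = of_nat p * g" "p \<noteq> 0"
  shows "f = g"
proof (rule poly_mapping_eqI)
  fix m
  show "Poly_Mapping.lookup f m = Poly_Mapping.lookup g m"
    using arg_cong[OF assms(1), of "\<lambda>h. Poly_Mapping.lookup h m"] assms(2)
    by (simp add: lookup_of_nat_mult)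
qed

text \<open>Already the power with exponent \<open>\<bar>z\<bar>\<close> exceeds
  \<open>\<bar>z\<bar>\<close>. Both arguments by repeated division by \<open>p\<close> end
  here.\<close>

lemma int_eq_0_if_all_powers_dvd:
  fixes z :: int
  assumes "p \<ge> 2" "\<And>k. int p ^ k dvd z"
  shows "z = 0"
proof (rule ccontr)
  assume "z \<noteq> 0"
  have "int p ^ nat \<bar>z\<bar> \<le> \<bar>z\<bar>"
    using dvd_imp_le_int[OF \<open>z \<noteq> 0\<close> assms(2)[of "nat \<bar>z\<bar>"]] by simp
  moreover have "nat \<bar>z\<bar> < p ^ nat \<bar>z\<bar>"
    using assms(1) by (intro power_gt_expt) simp
  then have "int (nat \<bar>z\<bar>) < int p ^ nat \<bar>z\<bar>"
    by (simp only: of_nat_less_iff flip: of_nat_power)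
  ultimately show False by simp
qed

lemma homogeneous_mpoly_of_int: "homogeneous d f \<Longrightarrow> homogeneous d (mpoly_of_int f)"
  unfolding homogeneous_iff lookup_mpoly_of_int by (metis of_int_0)

text \<open>Clearing denominators gives \<open>m g = \<beta> h\<close> over the integers, where
  \<open>p\<close> might divide \<open>m\<close>. A least positive \<open>m\<close> excludes this:
  otherwise \<open>\<beta> h\<close> vanishes modulo \<open>p\<close>, hence so does
  \<open>h\<close>, and both sides can be divided by \<open>p\<close>. So \<open>m\<close> is
  invertible modulo \<open>p\<close>.\<close>

lemma dvd_rat_imp_dvd_mod:
  fixes \<beta> g :: "('l::finite, int) mpoly"
  assumes \<beta>: "homogeneous 1 \<beta>" "(mpoly_of_int \<beta> :: ('l, 'p::prime_card mod_ring) mpoly) \<noteq> 0"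
    and dvd: "(mpoly_of_int \<beta> :: ('l, rat) mpoly) dvd mpoly_of_int g"
  shows "(mpoly_of_int \<beta> :: ('l, 'p mod_ring) mpoly) dvd mpoly_of_int g"
proof -
  define p where "p = CARD('p)"
  have p: "p \<ge> 2" using prime_card[where 'a = 'p] by (simp add: p_def prime_ge_2_nat)
  define P where "P c \<longleftrightarrow> c > 0 \<and> \<beta> dvd of_nat c * g" for c :: nat
  obtain k where k: "(mpoly_of_int g :: ('l, rat) mpoly) = mpoly_of_int \<beta> * k"
    using dvd by (rule dvdE)
  obtain c k' where c: "c > 0" "Poly_Mapping.single 0 (of_int c) * k = mpoly_of_int k'"
    using clear_denominators[of "{()}" "\<lambda>_. k"] by (metis finite.emptyI finite_insert insertI1)
  obtain N where N: "c = int N" using c(1) by (metis zero_less_imp_eq_int)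
  have "P N"
  proof -
    have "(mpoly_of_int (of_nat (N) * g) :: ('l, rat) mpoly)
        = Poly_Mapping.single 0 (of_int c) * mpoly_of_int g"
      by (simp add: N mpoly_of_int_of_nat)
    also have "\<dots> = mpoly_of_int (\<beta> * k')"
      unfolding k mpoly_of_int_mult c(2)[symmetric] by (simp only: mult_ac)
    finally have "of_nat (N) * g = \<beta> * k'"
      by (simp only: mpoly_of_int_rat_inject)
    with c(1) show ?thesis unfolding P_def by (simp add: N)
  qed
  define m where "m = (LEAST c. P c)"
  have "P m" unfolding m_def using \<open>P (N)\<close> by (rule LeastI)
  then obtain h where h: "m > 0" "of_nat m * g = \<beta> * h"
    unfolding P_def by (metis dvdE)
  have of_m: "(mpoly_of_int (of_nat m * g) :: ('l, 'p mod_ring) mpoly)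
      = Poly_Mapping.single 0 (of_nat m) * mpoly_of_int g"
    by (simp add: mpoly_of_int_of_nat)
  have "(of_nat m :: 'p mod_ring) \<noteq> 0"
  proof
    assume 0: "(of_nat m :: 'p mod_ring) = 0"
    then have "p dvd m"
      using of_int_mod_ring_eq_0_iff[where 'p = 'p, of "int m"] by (simp add: p_def)
    then obtain m' where m': "m = p * m'" by (rule dvdE)
    have "(mpoly_of_int \<beta> :: ('l, 'p mod_ring) mpoly) * mpoly_of_int h = 0"
      using of_m 0 unfolding h(2) by simp
    then have "(mpoly_of_int h :: ('l, 'p mod_ring) mpoly) = 0"
      by (rule linear_form_mult_eq_0[OF homogeneous_mpoly_of_int[OF \<beta>(1)] \<beta>(2)])
    then obtain h' where h': "h = of_nat p * h'"
      unfolding mpoly_of_int_mod_eq_0_iff p_def[symmetric] by (rule dvdE)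
    have "of_nat p * (of_nat m' * g) = of_nat p * (\<beta> * h')"
      using h(2) unfolding m' h' of_nat_mult by (simp only: mult_ac)
    then have "of_nat m' * g = \<beta> * h'"
      by (rule of_nat_mult_cancel) (use p in simp)
    then have "P m'" using h(1) m' unfolding P_def by simp
    then have "m \<le> m'" unfolding m_def by (rule Least_le)
    then show False using m' h(1) p by simp
  qed
  then have "mpoly_of_int g = Poly_Mapping.single 0 (inverse (of_nat m :: 'p mod_ring) * of_nat m) * mpoly_of_int g"
    by simp
  also have "\<dots> = Poly_Mapping.single 0 (inverse (of_nat m)) * (Poly_Mapping.single 0 (of_nat m) * mpoly_of_int g)"
    by (simp only: single_mult_single_0 flip: mult.assoc)
  also have "\<dots> = mpoly_of_int \<beta> * (Poly_Mapping.single 0 (inverse (of_nat m)) * mpoly_of_int h)"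
    unfolding of_m[symmetric] h(2) mpoly_of_int_mult by (simp only: mult_ac)
  finally show ?thesis by (metis dvd_triv_left)
qed


subsection \<open>Lifting logarithmic derivations\<close>

text \<open>Turns ideal membership into the existence of a derivation, which is the object needed to
  correct a lift.\<close>

lemma jacobian_ideal_iff:
  "g \<in> jacobian_ideal Q \<longleftrightarrow> (\<exists>\<theta> h. g = deriv_apply \<theta> Q + h * Q)"
proof
  assume "g \<in> jacobian_ideal Q"
  then obtain h where h: "g - h * Q \<in> ring_mod.span (range (\<lambda>i. mpoly_partial i Q))"
    unfolding jacobian_ideal_def ring_mod.span_insert by blast
  have "\<exists>\<theta>. x = deriv_apply \<theta> Q" if "x \<in> ring_mod.span (range (\<lambda>i. mpoly_partial i Q))" for x
    using that
  proof (induction rule: ring_mod.span_induct_alt)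
    case base
    show ?case by (rule exI[of _ 0]) (simp add: deriv_apply_def)
  next
    case (step c x y)
    then obtain i \<theta> where i: "x = mpoly_partial i Q" "y = deriv_apply \<theta> Q" by blast
    \<comment> \<open>\<open>axis i c\<close> is the derivation \<open>c\<close> times the
      \<open>i\<close>-th partial derivative.\<close>
    have "deriv_apply (axis i c) Q = (\<Sum>j\<in>UNIV. if j = i then c * mpoly_partial j Q else 0)"
      unfolding deriv_apply_def by (rule sum.cong) (auto simp: axis_def)
    then have "c * x + y = deriv_apply (axis i c + \<theta>) Q"
      by (simp add: i deriv_apply_add_left)
    then show ?case by blast
  qed
  with h obtain \<theta> where "g - h * Q = deriv_apply \<theta> Q" by blast
  then have "g = deriv_apply \<theta> Q + h * Q" by (simp add: diff_eq_eq)
  then show "\<exists>\<theta> h. g = deriv_apply \<theta> Q + h * Q" by blast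
next
  assume "\<exists>\<theta> h. g = deriv_apply \<theta> Q + h * Q"
  then obtain \<theta> h where g: "g = deriv_apply \<theta> Q + h * Q" by blast
  show "g \<in> jacobian_ideal Q"
    unfolding g jacobian_ideal_def deriv_apply_def
    by (intro ring_mod.span_add ring_mod.span_sum ring_mod.span_scale ring_mod.span_base) auto
qed

lemma lift_mod_derivation:
  fixes Q :: "('l::finite, int) mpoly" and \<delta> :: "('l, 'p::prime_card mod_ring) mpoly ^ 'l"
  assumes nzd: "\<not> zero_divisor_mod (of_nat CARD('p)) (jacobian_ideal Q)"
    and dvd: "mpoly_of_int Q dvd deriv_apply \<delta> (mpoly_of_int Q)"
  obtains \<theta> where "vec_of_int \<theta> = \<delta>" "Q dvd deriv_apply \<theta> Q"
proof -
  define p where "p = CARD('p)"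
  have "\<forall>i. \<exists>t. mpoly_of_int t = \<delta> $ i"
    by (metis mpoly_of_int_surj_mod)
  then obtain t where t: "\<And>i. mpoly_of_int (t i) = \<delta> $ i" by metis
  define \<theta>\<^sub>0 where "\<theta>\<^sub>0 = (\<chi> i. t i)"
  have \<theta>\<^sub>0: "vec_of_int \<theta>\<^sub>0 = \<delta>" by (simp add: vec_eq_iff \<theta>\<^sub>0_def t)
  obtain k where "deriv_apply \<delta> (mpoly_of_int Q) = mpoly_of_int Q * k"
    using dvd by (rule dvdE)
  moreover obtain h where "mpoly_of_int h = k" by (rule mpoly_of_int_surj_mod)
  ultimately have "(mpoly_of_int (deriv_apply \<theta>\<^sub>0 Q + (- h) * Q) :: ('l, 'p mod_ring) mpoly) = 0"
    using mpoly_of_int_diff[of "deriv_apply \<theta>\<^sub>0 Q" "Q * h", where 'b = "'p mod_ring"]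
    by (simp add: mpoly_of_int_deriv_apply \<theta>\<^sub>0 mult.commute)
  then obtain g where g: "deriv_apply \<theta>\<^sub>0 Q + (- h) * Q = of_nat p * g"
    unfolding mpoly_of_int_mod_eq_0_iff p_def[symmetric] by (rule dvdE)
  then have "of_nat p * g \<in> jacobian_ideal Q"
    unfolding jacobian_ideal_iff by metis
  then have "g \<in> jacobian_ideal Q"
    using nzd unfolding zero_divisor_mod_def p_def by blast
  then obtain \<eta> b where ab: "g = deriv_apply \<eta> Q + b * Q"
    unfolding jacobian_ideal_iff by blast
  \<comment> \<open>The part \<open>\<eta>(Q)\<close> of \<open>g\<close> is absorbed by subtracting
    \<open>p \<eta>\<close>, which is invisible modulo \<open>p\<close>; what remains of the error
    is a multiple of \<open>Q\<close>.\<close>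
  define \<theta> where "\<theta> = \<theta>\<^sub>0 + (- of_nat p) *s \<eta>"
  have "deriv_apply \<theta> Q = deriv_apply \<theta>\<^sub>0 Q - of_nat p * deriv_apply \<eta> Q"
    unfolding \<theta>_def deriv_apply_add_left deriv_apply_smult by simp
  also have "\<dots> = Q * (h + of_nat p * b)"
  proof -
    have "deriv_apply \<theta>\<^sub>0 Q = h * Q + of_nat p * g"
      using g by (simp add: diff_eq_eq add.commute)
    then have "deriv_apply \<theta>\<^sub>0 Q - of_nat p * deriv_apply \<eta> Q
        = h * Q + of_nat p * (deriv_apply \<eta> Q + b * Q) - of_nat p * deriv_apply \<eta> Q"
      unfolding ab by (rule arg_cong)
    also have "\<dots> = h * Q + of_nat p * (b * Q)"
      by (simp add: distrib_left)
    finally show ?thesis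
      by (simp only: distrib_left mult_ac)
  qed
  finally have "Q dvd deriv_apply \<theta> Q" by simp
  moreover have "vec_of_int \<theta> = \<delta>"
  proof -
    have "(mpoly_of_int (- of_nat p) :: ('l, 'p mod_ring) mpoly) = 0"
      unfolding mpoly_of_int_mod_eq_0_iff p_def by simp
    then show ?thesis
      unfolding \<theta>_def vec_of_int_add vec_of_int_smult \<theta>\<^sub>0 by simp
  qed
  ultimately show thesis using that by blast
qed

subsection \<open>Bases over the polynomial ring\<close>

text \<open>Independence of the set \<open>range \<delta>\<close> does not see repetitions. Combined
  with injectivity it is independence of the family, a form that can be compared between the two
  coefficient fields.\<close>

lemma inj_independent_range_iff:
  fixes \<delta> :: "'l::finite \<Rightarrow> ('a::comm_ring_1) ^ 'n"
  shows "inj \<delta> \<and> vec_mod.independent (range \<delta>)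
    \<longleftrightarrow> (\<forall>f. (\<Sum>i\<in>UNIV. f i *s \<delta> i) = 0 \<longrightarrow> (\<forall>i. f i = 0))"
proof (intro iffI conjI allI impI)
  fix f i
  assume *: "inj \<delta> \<and> vec_mod.independent (range \<delta>)" and sum: "(\<Sum>i\<in>UNIV. f i *s \<delta> i) = 0"
  then have inj: "inj \<delta>" by blast
  define g where "g = the_inv \<delta>"
  have g: "g (\<delta> j) = j" for j
    unfolding g_def by (rule the_inv_f_f[OF inj])
  have sum': "(\<Sum>v\<in>range \<delta>. f (g v) *s v) = 0"
    unfolding sum.reindex[OF inj] o_def g by (rule sum)
  show "f i = 0"
  proof (rule ccontr)
    assume "f i \<noteq> 0"
    then have "\<exists>v\<in>range \<delta>. f (g v) \<noteq> 0"
      by (intro bexI[of _ "\<delta> i"]) (simp_all add: g)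
    with sum' have "vec_mod.dependent (range \<delta>)"
      unfolding vec_mod.dependent_finite[OF finite_imageI[OF finite]]
      by (intro exI[of _ "\<lambda>v. f (g v)"] conjI)
    with * show False by blast
  qed
next
  assume *: "\<forall>f. (\<Sum>i\<in>UNIV. f i *s \<delta> i) = 0 \<longrightarrow> (\<forall>i. f i = 0)"
  show inj: "inj \<delta>"
  proof (rule injI, rule ccontr)
    fix i j assume eq: "\<delta> i = \<delta> j" and "i \<noteq> j"
    define f where "f = (\<lambda>k. if k = i then 1 else if k = j then - 1 else (0 :: 'a))"
    have "f k *s \<delta> k = (if k = i then \<delta> i else 0) + (if k = j then - \<delta> j else 0)" for k
      using \<open>i \<noteq> j\<close> by (simp add: f_def)
    then have "(\<Sum>k\<in>UNIV. f k *s \<delta> k) = 0"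
      by (simp add: sum.distrib eq)
    then have "f i = 0" using *[rule_format, of f] by blast
    then show False by (simp add: f_def)
  qed
  show "vec_mod.independent (range \<delta>)"
  proof
    assume "vec_mod.dependent (range \<delta>)"
    then obtain u where u: "\<exists>v\<in>range \<delta>. u v \<noteq> 0" "(\<Sum>v\<in>range \<delta>. u v *s v) = 0"
      unfolding vec_mod.dependent_finite[OF finite_imageI[OF finite]] by blast
    from u(2) have "(\<Sum>i\<in>UNIV. u (\<delta> i) *s \<delta> i) = 0"
      unfolding sum.reindex[OF inj] o_def .
    with *[rule_format, of "\<lambda>i. u (\<delta> i)"] u(1) show False by blast
  qed
qed

lemma span_range_obtain:
  fixes \<delta> :: "'l::finite \<Rightarrow> ('a::comm_ring_1) ^ 'n"
  assumes "x \<in> vec_mod.span (range \<delta>)" "inj \<delta>"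
  obtains f where "x = (\<Sum>i\<in>UNIV. f i *s \<delta> i)"
proof -
  obtain u where "x = (\<Sum>v\<in>range \<delta>. u v *s v)"
    using assms(1) unfolding vec_mod.span_finite[OF finite_imageI[OF finite]] by blast
  then have "x = (\<Sum>i\<in>UNIV. u (\<delta> i) *s \<delta> i)"
    unfolding sum.reindex[OF assms(2)] o_def .
  then show thesis by (rule that)
qed

text \<open>In an integral relation all coefficients vanish modulo \<open>p\<close>; dividing them
  by \<open>p\<close> gives another integral relation, so they are divisible by every power of
  \<open>p\<close>.\<close>

lemma lift_independence:
  fixes \<theta> :: "'l::finite \<Rightarrow> ('l, int) mpoly ^ 'l"
  assumes ind: "\<And>f i. (\<Sum>i\<in>UNIV. f i *s (vec_of_int (\<theta> i) :: ('l, 'p::prime_card mod_ring) mpoly ^ 'l)) = 0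
      \<Longrightarrow> f i = 0"
    and sum: "(\<Sum>i\<in>UNIV. f i *s (vec_of_int (\<theta> i) :: ('l, rat) mpoly ^ 'l)) = 0"
  shows "f i = 0"
proof -
  define p where "p = CARD('p)"
  have p: "p \<ge> 2" using prime_card[where 'a = 'p] by (simp add: p_def prime_ge_2_nat)
  have powers: "\<forall>i m. int p ^ k dvd Poly_Mapping.lookup (g i) m"
    if "(\<Sum>i\<in>UNIV. g i *s \<theta> i) = 0" for g k
    using that
  proof (induction k arbitrary: g)
    case (Suc k)
    have "(\<Sum>i\<in>UNIV. mpoly_of_int (g i) *s (vec_of_int (\<theta> i) :: ('l, 'p mod_ring) mpoly ^ 'l)) = vec_of_int 0"
      unfolding Suc.prems[symmetric] vec_of_int_sum vec_of_int_smult ..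
    then have "(\<Sum>i\<in>UNIV. mpoly_of_int (g i) *s (vec_of_int (\<theta> i) :: ('l, 'p mod_ring) mpoly ^ 'l)) = 0"
      by (simp add: vec_eq_iff)
    then have "(mpoly_of_int (g i) :: ('l, 'p mod_ring) mpoly) = 0" for i
      by (rule ind)
    then have "\<forall>i. \<exists>h. g i = of_nat p * h"
      unfolding mpoly_of_int_mod_eq_0_iff p_def[symmetric] by (metis dvdE)
    then obtain h where h: "\<And>i. g i = of_nat p * h i" by metis
    have "(\<Sum>i\<in>UNIV. h i *s \<theta> i) = 0"
    proof -
      have "of_nat p * (\<Sum>i\<in>UNIV. h i *s \<theta> i) $ j = of_nat p * 0" for j
      proof -
        have "of_nat p * (\<Sum>i\<in>UNIV. h i *s \<theta> i) $ j = (\<Sum>i\<in>UNIV. g i *s \<theta> i) $ j"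
          unfolding h sum_component vector_smult_component sum_distrib_left by (simp only: mult.assoc)
        then show ?thesis by (simp add: Suc.prems)
      qed
      then have "(\<Sum>i\<in>UNIV. h i *s \<theta> i) $ j = 0" for j
        by (rule of_nat_mult_cancel) (use p in simp)
      then show ?thesis unfolding vec_eq_iff zero_index by blast
    qed
    from Suc.IH[OF this] show ?case
      unfolding h lookup_of_nat_mult by (simp add: mult_dvd_mono)
  qed simp
  obtain c g where c: "c > (0::int)" "\<And>i. Poly_Mapping.single 0 (of_int c) * f i = mpoly_of_int (g i)"
    using clear_denominators[of UNIV f] by (metis UNIV_I finite)
  have "(vec_of_int (\<Sum>i\<in>UNIV. g i *s \<theta> i) :: ('l, rat) mpoly ^ 'l)
      = Poly_Mapping.single 0 (of_int c) *s (\<Sum>i\<in>UNIV. f i *s vec_of_int (\<theta> i))"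
    unfolding vec_of_int_sum vec_of_int_smult c(2)[symmetric] vec_mod.scale_sum_right vec_mod.scale_scale ..
  then have "(vec_of_int (\<Sum>i\<in>UNIV. g i *s \<theta> i) :: ('l, rat) mpoly ^ 'l) = vec_of_int 0"
    unfolding sum by (simp add: vec_eq_iff)
  then have "(\<Sum>i\<in>UNIV. g i *s \<theta> i) = 0"
    unfolding vec_eq_iff vec_of_int_nth mpoly_of_int_rat_inject .
  then have "int p ^ k dvd Poly_Mapping.lookup (g i) m" for k m
    using powers by blast
  then have "Poly_Mapping.lookup (g i) m = 0" for m
    using int_eq_0_if_all_powers_dvd[OF p] by blast
  then have "g i = 0" by (intro poly_mapping_eqI) simp
  then have *: "Poly_Mapping.single 0 (of_int c) * f i = 0" using c(2)[of i] by simp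
  show ?thesis
  proof (rule poly_mapping_eqI)
    fix m
    from * have "of_int c * Poly_Mapping.lookup (f i) m = 0"
      using lookup_const_mult[of "of_int c" "f i" m] by simp
    with c(1) show "Poly_Mapping.lookup (f i) m = Poly_Mapping.lookup 0 m" by simp
  qed
qed


subsection \<open>Descent along the prime number\<close>

text \<open>Since \<open>x\<close> is outside \<open>V\<close>, it extends a basis of
  \<open>V\<close> to an independent set; the functional is the coordinate of
  \<open>x\<close>.\<close>

lemma (in vector_space) separating_functional:
  assumes "subspace V" "x \<notin> V"
  obtains \<phi> where "\<And>v w. \<phi> (v + w) = \<phi> v + \<phi> w" "\<And>c v. \<phi> (scale c v) = c * \<phi> v"
    "\<And>v. v \<in> V \<Longrightarrow> \<phi> v = 0" "\<phi> x = 1"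
proof -
  interpret vector_space_pair scale "(*)"
    by unfold_locales (simp_all only: distrib_left distrib_right mult.assoc mult_1)
  obtain B where B: "B \<subseteq> V" "independent B" "V \<subseteq> span B"
    using maximal_independent_subset by blast
  have V: "span B = V"
    using span_minimal[OF B(1) assms(1)] B(3) by (rule subset_antisym)
  then have ind: "independent (insert x B)"
    using assms(2) B(2) by (intro independent_insertI) simp_all
  define \<phi> where "\<phi> = construct (insert x B) (\<lambda>b. if b = x then 1 else 0)"
  interpret \<phi>: Vector_Spaces.linear scale "(*)" \<phi>
    unfolding \<phi>_def using ind by (rule linear_construct)
  have basis: "\<phi> b = (if b = x then 1 else 0)" if "b \<in> insert x B" for b
    unfolding \<phi>_def using ind that by (rule construct_basis)
  have "\<phi> b = 0" if "b \<in> B" for b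
  proof -
    have "b \<noteq> x" using that B(1) assms(2) by blast
    then show ?thesis using basis[of b] that by simp
  qed
  then have "\<phi> v = 0" if "v \<in> V" for v
    using that unfolding V[symmetric] by (rule \<phi>.eq_0_on_span)
  moreover have "\<phi> x = 1" using basis[of x] by simp
  ultimately show thesis
    by (rule that[OF \<phi>.add \<phi>.scale])
qed

text \<open>Scalars are restricted to constant polynomials: over the field, unlike over the
  polynomial ring, a vector outside a subspace can always be separated from it.\<close>

lemma vector_space_mpoly_vec:
  "vector_space (\<lambda>(c::'a::field) (v :: ('l, 'a) mpoly ^ 'n). Poly_Mapping.single 0 c *s v)"
  by unfold_locales
    (simp_all only: single_add single_mult_single_0[symmetric] vec_mod.scale_left_distrib
      vec_mod.scale_right_distrib vec_mod.scale_scale single_one vec_mod.scale_one)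

lemma common_denominator:
  fixes r :: "'b \<Rightarrow> rat"
  assumes "finite A"
  obtains M z where "M > (0::int)" "\<And>x. x \<in> A \<Longrightarrow> of_int M * r x = of_int (z x)"
proof -
  \<comment> \<open>The rational numbers are treated as constant polynomials over the dummy index
    type \<open>unit\<close>.\<close>
  obtain M g where M: "M > (0::int)"
    and g: "\<And>x. x \<in> A \<Longrightarrow> Poly_Mapping.single 0 (of_int M) * (Poly_Mapping.single 0 (r x) :: (unit, rat) mpoly)
      = mpoly_of_int (g x)"
    using clear_denominators[OF assms, of "\<lambda>x. Poly_Mapping.single 0 (r x)"] by blast
  have "of_int M * r x = of_int (Poly_Mapping.lookup (g x) 0)" if "x \<in> A" for x
    using arg_cong[OF g[OF that], of "\<lambda>h. Poly_Mapping.lookup h 0"]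
    unfolding single_mult_single_0 by simp
  with M show thesis by (rule that)
qed

text \<open>Integer coordinates in the monomial derivations of degree \<open>d\<close>. The index
  set is finite and depends on \<open>d\<close> only, so finitely many values determine a functional
  on this degree.\<close>

lemma expand_has_pdeg:
  fixes \<eta> :: "('l::finite, int) mpoly ^ 'l"
  assumes "has_pdeg \<eta> d"
  shows "(vec_of_int \<eta> :: ('l, 'a::comm_ring_1) mpoly ^ 'l)
    = (\<Sum>(i, m)\<in>UNIV \<times> {m. mdeg m = d}.
        Poly_Mapping.single 0 (of_int (Poly_Mapping.lookup (\<eta> $ i) m)) *s axis i (Poly_Mapping.single m 1))"
proof -
  have "mpoly_of_int (\<eta> $ j) = (\<Sum>(i, m)\<in>UNIV \<times> {m. mdeg m = d}.
        Poly_Mapping.single 0 (of_int (Poly_Mapping.lookup (\<eta> $ i) m) :: 'a)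
          * (axis i (Poly_Mapping.single m 1) $ j))" for j
  proof -
    have "mpoly_of_int (\<eta> $ j) = mpoly_of_int (hcomp d (\<eta> $ j))"
      using assms hcomp_homogeneous[of d "\<eta> $ j" d] by (simp add: has_pdeg_def)
    also have "\<dots> = (\<Sum>m | mdeg m = d. Poly_Mapping.single m (of_int (Poly_Mapping.lookup (\<eta> $ j) m)))"
      unfolding hcomp_def mpoly_of_int_sum mpoly_of_int_single ..
    also have "\<dots> = (\<Sum>i\<in>UNIV. if i = j then (\<Sum>m | mdeg m = d.
        Poly_Mapping.single m (of_int (Poly_Mapping.lookup (\<eta> $ i) m))) else 0)"
      by simp
    also have "\<dots> = (\<Sum>i\<in>UNIV. \<Sum>m | mdeg m = d.
        Poly_Mapping.single 0 (of_int (Poly_Mapping.lookup (\<eta> $ i) m) :: 'a)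
          * (axis i (Poly_Mapping.single m 1) $ j))"
    proof (rule sum.cong)
      fix i
      show "(if i = j then (\<Sum>m | mdeg m = d. Poly_Mapping.single m (of_int (Poly_Mapping.lookup (\<eta> $ i) m))) else 0)
        = (\<Sum>m | mdeg m = d. Poly_Mapping.single 0 (of_int (Poly_Mapping.lookup (\<eta> $ i) m) :: 'a)
          * (axis i (Poly_Mapping.single m 1) $ j))"
        by (auto simp: axis_def single_mult_single_0 simp del: single_of_int)
    qed simp
    also have "\<dots> = (\<Sum>(i, m)\<in>UNIV \<times> {m. mdeg m = d}.
        Poly_Mapping.single 0 (of_int (Poly_Mapping.lookup (\<eta> $ i) m) :: 'a)
          * (axis i (Poly_Mapping.single m 1) $ j))"
      by (rule sum.cartesian_product)
    finally show ?thesis .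
  qed
  then show ?thesis
    unfolding vec_eq_iff sum_component vec_of_int_nth case_prod_unfold vector_smult_component by blast
qed

text \<open>
  A linear functional vanishing on \<open>V\<close> has bounded denominators on integral vectors of a fixed
  degree, but the hypothesis makes its values there divisible by every power of \<open>p\<close>.
\<close>

lemma descent:
  fixes V :: "(('l::finite, rat) mpoly ^ 'l) set" and D :: "(('l, int) mpoly ^ 'l) set"
  assumes "p \<ge> 2" and V: "vec_mod.subspace V"
    and pdeg: "\<And>\<eta>. \<eta> \<in> D \<Longrightarrow> has_pdeg \<eta> d"
    and step: "\<And>\<eta>. \<eta> \<in> D \<Longrightarrow> \<exists>v\<in>V. \<exists>\<eta>'\<in>D. vec_of_int \<eta> = v + Poly_Mapping.single 0 (of_nat p) *s vec_of_int \<eta>'"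
    and \<eta>: "\<eta> \<in> D"
  shows "vec_of_int \<eta> \<in> V"
proof (rule ccontr)
  assume "vec_of_int \<eta> \<notin> V"
  moreover interpret rat: vector_space
    "\<lambda>(c::rat) (v :: ('l, rat) mpoly ^ 'l). Poly_Mapping.single 0 c *s v"
    by (rule vector_space_mpoly_vec)
  have "rat.subspace V"
    using V unfolding rat.subspace_def vec_mod.subspace_def by blast
  ultimately obtain \<phi> where add: "\<And>v w. \<phi> (v + w) = \<phi> v + \<phi> w"
    and scale: "\<And>c v. \<phi> (Poly_Mapping.single 0 c *s v) = c * \<phi> v"
    and zero: "\<And>v. v \<in> V \<Longrightarrow> \<phi> v = 0" and one: "\<phi> (vec_of_int \<eta>) = 1"
    using rat.separating_functional by blast
  have sum: "\<phi> (\<Sum>x\<in>A. g x) = (\<Sum>x\<in>A. \<phi> (g x))" for A and g :: "'l \<times> ('l \<Rightarrow>\<^sub>0 nat) \<Rightarrow> _"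
    using add scale[of 0 0] by (induction A rule: infinite_finite_induct) simp_all
  let ?B = "UNIV \<times> {m. mdeg m = d} :: ('l \<times> ('l \<Rightarrow>\<^sub>0 nat)) set"
  have "finite ?B" by (intro finite_cartesian_product finite finite_mdeg_eq)
  then obtain M z where M: "M > (0::int)"
    and z: "\<And>x. x \<in> ?B \<Longrightarrow> of_int M * (case x of (i, m) \<Rightarrow> \<phi> (axis i (Poly_Mapping.single m 1))) = of_int (z x)"
    using common_denominator[of ?B "\<lambda>x. case x of (i, m) \<Rightarrow> \<phi> (axis i (Poly_Mapping.single m 1))"] by blast
  \<comment> \<open>The value of \<open>\<phi>\<close> scaled by \<open>M\<close>, expressed as an
    integer so that divisibility by powers of \<open>p\<close> makes sense.\<close>
  define w where "w \<zeta> = (\<Sum>(i, m)\<in>?B. Poly_Mapping.lookup (\<zeta> $ i) m * z (i, m))" for \<zeta> :: "('l, int) mpoly ^ 'l"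
  have w: "of_int (w \<zeta>) = of_int M * \<phi> (vec_of_int \<zeta>)" if "\<zeta> \<in> D" for \<zeta>
  proof -
    have "of_int M * \<phi> (vec_of_int \<zeta>)
      = (\<Sum>x\<in>?B. of_int M * (case x of (i, m) \<Rightarrow> of_int (Poly_Mapping.lookup (\<zeta> $ i) m)
          * \<phi> (axis i (Poly_Mapping.single m 1))))"
      unfolding expand_has_pdeg[OF pdeg[OF that]] sum sum_distrib_left case_prod_unfold scale ..
    also have "\<dots> = (\<Sum>x\<in>?B. of_int (case x of (i, m) \<Rightarrow> Poly_Mapping.lookup (\<zeta> $ i) m * z (i, m)))"
    proof (rule sum.cong)
      fix x assume "x \<in> ?B"
      from z[OF this] show "of_int M * (case x of (i, m) \<Rightarrow> of_int (Poly_Mapping.lookup (\<zeta> $ i) m)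
          * \<phi> (axis i (Poly_Mapping.single m 1)))
        = of_int (case x of (i, m) \<Rightarrow> Poly_Mapping.lookup (\<zeta> $ i) m * z (i, m))"
        by (cases x) (simp add: mult.left_commute)
    qed simp
    finally show ?thesis unfolding w_def of_int_sum by simp
  qed
  \<comment> \<open>Each application of \<open>step\<close> stays in \<open>D\<close> and extracts
    one factor \<open>p\<close>, because \<open>\<phi>\<close> kills the part in
    \<open>V\<close>.\<close>
  have powers: "int p ^ k dvd w \<zeta>" if "\<zeta> \<in> D" for k \<zeta>
    using that
  proof (induction k arbitrary: \<zeta>)
    case (Suc k)
    obtain v \<eta>' where v: "v \<in> V" "\<eta>' \<in> D"
      and eq: "vec_of_int \<zeta> = v + Poly_Mapping.single 0 (of_nat p) *s vec_of_int \<eta>'"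
      using step[OF Suc.prems] by blast
    have "\<phi> (vec_of_int \<zeta>) = of_nat p * \<phi> (vec_of_int \<eta>')"
      unfolding eq add scale zero[OF v(1)] by simp
    then have "(of_int (w \<zeta>) :: rat) = of_int (int p * w \<eta>')"
      by (simp add: w[OF Suc.prems] w[OF v(2)])
    then have "w \<zeta> = int p * w \<eta>'"
      by (simp only: of_int_eq_iff)
    with Suc.IH[OF v(2)] show ?case by (simp add: mult_dvd_mono)
  qed simp
  have "w \<eta> = 0"
    using powers[OF \<eta>] by (rule int_eq_0_if_all_powers_dvd[OF \<open>p \<ge> 2\<close>])
  with w[OF \<eta>] one M show False by simp
qed

theorem theorem6p1:
  fixes A :: "(rat ^ 'l::finite) set set"
    and H :: "nat \<Rightarrow> (rat ^ 'l) set"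
    and \<alpha> :: "nat \<Rightarrow> ('l, int) mpoly"
    and n p :: nat
    and e :: "'l \<Rightarrow> nat"
  assumes "central_arrangement A"
    and "A = H ` {1..n}" and "inj_on H {1..n}"
    and "\<And>i. i \<in> {1..n} \<Longrightarrow> homogeneous 1 (\<alpha> i)"
    and "\<And>i. i \<in> {1..n} \<Longrightarrow> defining_form (mpoly_of_int (\<alpha> i)) (H i)"
    and "\<And>i q :: nat. i \<in> {1..n} \<Longrightarrow> prime q \<Longrightarrow> \<not> of_nat q dvd \<alpha> i"
    and "prime p" and "CARD('p::prime_card) = p"
    and good: "squarefree (mpoly_of_int (arrangement_poly \<alpha> n) :: ('l, 'p mod_ring) mpoly)"
    and "\<not> p dvd n"
    and "\<not> zero_divisor_mod (of_nat p) (jacobian_ideal (arrangement_poly \<alpha> n))"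
    and "free_with_exponents (reduced_arrangement \<alpha> n :: ('p mod_ring ^ 'l) set set) e"
  shows "free_with_exponents A e"
proof -

  \<comment> \<open>Both modules of logarithmic derivations in terms of the integral forms\<close>
  let ?rat = "mpoly_of_int :: _ \<Rightarrow> ('l, rat) mpoly" and ?mod = "mpoly_of_int :: _ \<Rightarrow> ('l, 'p mod_ring) mpoly"
  let ?Q = "arrangement_poly \<alpha> n"
  let ?Ap = "reduced_arrangement \<alpha> n :: ('p mod_ring ^ 'l) set set"
  let ?I = "{1..n}"
  have hom: "homogeneous 1 (\<alpha> i)" if "i \<in> ?I" for i using assms(4)[OF that] .
  have rat: "homogeneous 1 (?rat (\<alpha> i))" "?rat (\<alpha> i) \<noteq> 0" "H i = zero_locus (?rat (\<alpha> i))"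
    if "i \<in> ?I" for i
    using assms(5)[OF that] by (simp_all add: defining_form_def)
  have mod: "homogeneous 1 (?mod (\<alpha> i))" "?mod (\<alpha> i) \<noteq> 0" if "i \<in> ?I" for i
    using homogeneous_mpoly_of_int[OF hom[OF that]] assms(6)[OF that \<open>prime p\<close>]
    unfolding mpoly_of_int_mod_eq_0_iff \<open>CARD('p) = p\<close> by blast+
  have "A = (\<lambda>i. zero_locus (?rat (\<alpha> i))) ` ?I"
    unfolding assms(2) by (rule image_cong) (simp_all add: rat(3))
  then have logA: "\<delta> \<in> log_derivations A \<longleftrightarrow> (\<forall>i\<in>?I. ?rat (\<alpha> i) dvd deriv_apply \<delta> (?rat (\<alpha> i)))" for \<delta>
    by (simp only: log_derivations_iff[OF rat(1,2)])
  have logAp: "\<delta> \<in> log_derivations ?Ap \<longleftrightarrow> (\<forall>i\<in>?I. ?mod (\<alpha> i) dvd deriv_apply \<delta> (?mod (\<alpha> i)))" for \<delta>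
    unfolding reduced_arrangement_def by (rule log_derivations_iff[OF mod])
  have nprop: "?rat (\<alpha> i) \<noteq> Poly_Mapping.single 0 c * ?rat (\<alpha> j)"
    if ij: "i \<in> ?I" "j \<in> ?I" "i \<noteq> j" for i j c
  proof
    assume eq: "?rat (\<alpha> i) = Poly_Mapping.single 0 c * ?rat (\<alpha> j)"
    then have "c \<noteq> 0" using rat(2)[OF ij(1)] by auto
    then have "H i = H j"
      unfolding rat(3)[OF ij(1)] rat(3)[OF ij(2)] eq by (rule zero_locus_const_mult[OF rat(1)[OF ij(2)]])
    with assms(3) ij show False by (metis inj_onD)
  qed
  have graded: "vhcomp d \<delta> \<in> log_derivations A" if "\<delta> \<in> log_derivations A" for d \<delta>
    unfolding logA
  proof
    fix i assume i: "i \<in> ?I"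
    show "?rat (\<alpha> i) dvd deriv_apply (vhcomp d \<delta>) (?rat (\<alpha> i))"
      unfolding hcomp_deriv_apply_linear_form[OF rat(1)[OF i], symmetric]
      using that i by (intro dvd_hcomp[OF rat(1)[OF i]]) (simp only: logA)
  qed

  \<comment> \<open>Membership is tested over the rationals, so \<open>p \<zeta> \<in> D\<close>
    implies \<open>\<zeta> \<in> D\<close>; the descent relies on this saturation.\<close>
  define D where "D = {\<theta> :: ('l, int) mpoly ^ 'l. vec_of_int \<theta> \<in> log_derivations A}"
  have reduce: "vec_of_int \<theta> \<in> log_derivations ?Ap" if "\<theta> \<in> D" for \<theta>
    unfolding logAp
  proof
    fix i assume i: "i \<in> ?I"
    have "?rat (\<alpha> i) dvd ?rat (deriv_apply \<theta> (\<alpha> i))"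
      using that i unfolding D_def mem_Collect_eq logA mpoly_of_int_deriv_apply by blast
    then show "?mod (\<alpha> i) dvd deriv_apply (vec_of_int \<theta>) (?mod (\<alpha> i))"
      unfolding mpoly_of_int_deriv_apply[symmetric] by (rule dvd_rat_imp_dvd_mod[OF hom[OF i] mod(2)[OF i]])
  qed
  have lift: "\<exists>\<theta>\<in>D. vec_of_int \<theta> = \<delta>" if "\<delta> \<in> log_derivations ?Ap" for \<delta>
  proof -
    \<comment> \<open>The separate conditions on the forms are merged into one on \<open>Q\<close>,
      the only polynomial for which lifting is available; they are separated again over the
      rationals.\<close>
    have "?mod ?Q dvd deriv_apply \<delta> (?mod ?Q)"
      unfolding arrangement_poly_def mpoly_of_int_prod
      using that by (intro prod_dvd_deriv_apply) (simp_all only: logAp finite_atLeastAtMost)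
    then obtain \<theta> where \<theta>: "vec_of_int \<theta> = \<delta>" "?Q dvd deriv_apply \<theta> ?Q"
      using lift_mod_derivation[of ?Q \<delta>] assms(11) unfolding \<open>CARD('p) = p\<close> by blast
    have "?rat ?Q dvd ?rat (deriv_apply \<theta> ?Q)"
      using \<theta>(2) by (metis dvd_def mpoly_of_int_mult)
    then have dvd: "(\<Prod>i\<in>?I. ?rat (\<alpha> i)) dvd deriv_apply (vec_of_int \<theta>) (\<Prod>i\<in>?I. ?rat (\<alpha> i))"
      unfolding mpoly_of_int_deriv_apply arrangement_poly_def mpoly_of_int_prod .
    have "\<theta> \<in> D"
      unfolding D_def mem_Collect_eq logA
    proof
      fix i assume i: "i \<in> ?I"
      show "?rat (\<alpha> i) dvd deriv_apply (vec_of_int \<theta>) (?rat (\<alpha> i))"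
        by (rule dvd_deriv_apply_factor[where a = "\<lambda>i. ?rat (\<alpha> i)" and I = ?I])
          (fact finite_atLeastAtMost rat nprop dvd i)+
    qed
    with \<theta>(1) show ?thesis by blast
  qed

  \<comment> \<open>A homogeneous integral lift of the basis\<close>
  obtain \<delta> where \<delta>: "inj \<delta>" "vec_mod.independent (range \<delta>)" "vec_mod.span (range \<delta>) = log_derivations ?Ap"
    "\<And>i. has_pdeg (\<delta> i) (e i)"
    using assms(12) unfolding free_with_exponents_def by blast
  have "\<delta> i \<in> log_derivations ?Ap" for i
    unfolding \<delta>(3)[symmetric] by (rule vec_mod.span_base) simp
  then have "\<forall>i. \<exists>\<theta>. \<theta> \<in> D \<and> vec_of_int \<theta> = \<delta> i"
    using lift by blast
  then obtain t where t: "\<And>i. t i \<in> D" "\<And>i. vec_of_int (t i) = \<delta> i"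
    by metis
  \<comment> \<open>The lift \<open>t i\<close> may be inhomogeneous. Its component of degree
    \<open>e i\<close> stays in \<open>D\<close> by gradedness and still reduces to
    \<open>\<delta> i\<close>, which is homogeneous of that degree.\<close>
  define \<theta> where "\<theta> i = vhcomp (e i) (t i)" for i
  have \<theta>_D: "\<theta> i \<in> D" for i
    using graded[of "vec_of_int (t i)" "e i"] t(1)[of i] unfolding \<theta>_def D_def vhcomp_vec_of_int by blast
  have \<theta>_mod: "vec_of_int (\<theta> i) = \<delta> i" for i
    unfolding \<theta>_def vhcomp_vec_of_int[symmetric] t(2) by (rule vhcomp_has_pdeg[OF \<delta>(4)])
  have \<theta>_pdeg: "has_pdeg (\<theta> i) (e i)" for i
    unfolding \<theta>_def by (rule has_pdeg_vhcomp)

  \<comment> \<open>Generation over the rationals\<close>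
  define V where "V = vec_mod.span (range (\<lambda>i. vec_of_int (\<theta> i) :: ('l, rat) mpoly ^ 'l))"
  have V: "vec_mod.subspace V"
    unfolding V_def by (rule vec_mod.subspace_span)
  have V_sub: "V \<subseteq> log_derivations A"
    unfolding V_def
    by (rule vec_mod.span_minimal[OF _ subspace_log_derivations]) (use \<theta>_D in \<open>auto simp: D_def\<close>)

  have step: "\<exists>v\<in>V. \<exists>\<eta>'\<in>{\<eta>\<in>D. has_pdeg \<eta> d}.
      vec_of_int \<eta> = v + Poly_Mapping.single 0 (of_nat p) *s vec_of_int \<eta>'"
    if "\<eta> \<in> {\<eta>\<in>D. has_pdeg \<eta> d}" for \<eta> d
  proof -
    from that have \<eta>: "\<eta> \<in> D" "has_pdeg \<eta> d" by blast+
    obtain f where f: "vec_of_int \<eta> = (\<Sum>i\<in>UNIV. f i *s \<delta> i)"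
      using span_range_obtain[OF _ \<delta>(1), of "vec_of_int \<eta>"] reduce[OF \<eta>(1)] unfolding \<delta>(3) by blast
    have "\<forall>i. \<exists>g. ?mod g = f i" by (metis mpoly_of_int_surj_mod)
    then obtain g where g: "\<And>i. ?mod (g i) = f i" by metis
    \<comment> \<open>An integral combination of the lifts that agrees with \<open>\<eta>\<close>
      modulo \<open>p\<close>; the difference supplies \<open>p \<zeta>\<close>.\<close>
    define u where "u = (\<Sum>i\<in>UNIV. g i *s \<theta> i)"
    have u_mod: "(vec_of_int u :: ('l, 'p mod_ring) mpoly ^ 'l) = vec_of_int \<eta>"
      unfolding u_def vec_of_int_sum vec_of_int_smult g \<theta>_mod f ..
    have "\<exists>h. \<eta> $ j - u $ j = of_nat p * h" for j
    proof -
      have "?mod (\<eta> $ j - u $ j) = 0"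
        using arg_cong[OF u_mod, of "\<lambda>x. x $ j"] by simp
      then show ?thesis
        unfolding mpoly_of_int_mod_eq_0_iff \<open>CARD('p) = p\<close> by (rule dvdE) blast
    qed
    then obtain h where h: "\<And>j. \<eta> $ j - u $ j = of_nat p * h j" by metis
    define \<zeta> where "\<zeta> = (\<chi> j. h j)"
    have \<zeta>: "\<eta> = u + of_nat p *s \<zeta>"
      unfolding vec_eq_iff by (simp add: \<zeta>_def h[symmetric])
    have p_const: "?rat (of_nat p) = Poly_Mapping.single 0 (of_nat p)"
      by (simp add: mpoly_of_int_of_nat)
    have "p \<noteq> 0" using \<open>prime p\<close> by auto
    have u_A: "vec_of_int u \<in> log_derivations A"
      unfolding u_def vec_of_int_sum vec_of_int_smult using \<theta>_D
      by (intro vec_mod.subspace_sum vec_mod.subspace_scale subspace_log_derivations) (simp add: D_def)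
    have "vec_of_int \<zeta> = Poly_Mapping.single 0 (1 / of_nat p) *s (vec_of_int \<eta> - vec_of_int u :: ('l, rat) mpoly ^ 'l)"
    proof -
      have "vec_of_int \<eta> - vec_of_int u = Poly_Mapping.single 0 (of_nat p :: rat) *s vec_of_int \<zeta>"
        unfolding \<zeta> vec_of_int_add vec_of_int_smult p_const by simp
      then show ?thesis
        using \<open>p \<noteq> 0\<close> by (simp only: vec_mod.scale_scale single_mult_single_0) simp
    qed
    also have "\<dots> \<in> log_derivations A"
      using \<eta>(1) u_A by (intro vec_mod.subspace_scale vec_mod.subspace_diff subspace_log_derivations)
        (simp_all add: D_def)
    finally have \<zeta>_D: "vec_of_int \<zeta> \<in> log_derivations A" .
    have vhcomp_u: "vhcomp d u = (\<Sum>i\<in>UNIV. (if e i \<le> d then hcomp (d - e i) (g i) else 0) *s \<theta> i)"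
      unfolding u_def vhcomp_sum vhcomp_smult[OF \<theta>_pdeg] ..
    \<comment> \<open>The coefficients \<open>g i\<close> are arbitrary lifts, so \<open>u\<close>
      and \<open>\<zeta>\<close> can have terms of other degrees. Projecting to degree
      \<open>d\<close> fixes \<open>\<eta>\<close>, keeps \<open>u\<close> in \<open>V\<close>
      because each \<open>\<theta> i\<close> is homogeneous, and keeps \<open>\<zeta>\<close> in
      \<open>D\<close>.\<close>
    have "vec_of_int \<eta> = (vhcomp d (vec_of_int \<eta>) :: ('l, rat) mpoly ^ 'l)"
      unfolding vhcomp_vec_of_int vhcomp_has_pdeg[OF \<eta>(2)] ..
    also have "\<dots> = vhcomp d (vec_of_int u) + Poly_Mapping.single 0 (of_nat p) *s vec_of_int (vhcomp d \<zeta>)"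
      by (subst (1) \<zeta>) (simp only: vec_of_int_add vec_of_int_smult p_const vhcomp_add vhcomp_const_smult vhcomp_vec_of_int)
    finally have "vec_of_int \<eta> = vhcomp d (vec_of_int u :: ('l, rat) mpoly ^ 'l)
      + Poly_Mapping.single 0 (of_nat p) *s vec_of_int (vhcomp d \<zeta>)" .
    moreover have "vhcomp d (vec_of_int u) \<in> V"
      unfolding vhcomp_vec_of_int vhcomp_u vec_of_int_sum vec_of_int_smult V_def
      by (intro vec_mod.span_sum vec_mod.span_scale vec_mod.span_base) simp
    moreover have "vhcomp d \<zeta> \<in> {\<eta>\<in>D. has_pdeg \<eta> d}"
      using graded[OF \<zeta>_D, of d] unfolding D_def vhcomp_vec_of_int by (simp add: has_pdeg_vhcomp)
    ultimately show ?thesis by blast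
  qed
  have p2: "p \<ge> 2" using \<open>prime p\<close> by (rule prime_ge_2_nat)
  have homog_V: "vhcomp d \<eta> \<in> V" if \<eta>: "\<eta> \<in> log_derivations A" for \<eta> d
  proof -
    obtain c k where c: "c > (0::int)"
      and k: "\<And>i. Poly_Mapping.single 0 (of_int c) * (\<eta> $ i) = ?rat (k i)"
      using clear_denominators[of UNIV "\<lambda>i. \<eta> $ i"] by (metis UNIV_I finite)
    define \<zeta> where "\<zeta> = (\<chi> i. k i)"
    have \<zeta>: "vec_of_int \<zeta> = Poly_Mapping.single 0 (of_int c) *s \<eta>"
      unfolding vec_eq_iff vec_of_int_nth vector_smult_component k \<zeta>_def vec_lambda_beta by blast
    have "vec_of_int (vhcomp d \<zeta>) \<in> log_derivations A"
      unfolding vhcomp_vec_of_int[symmetric] \<zeta>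
      by (intro graded vec_mod.subspace_scale subspace_log_derivations \<eta>)
    then have \<zeta>_D: "vhcomp d \<zeta> \<in> {\<eta>\<in>D. has_pdeg \<eta> d}"
      by (simp add: D_def has_pdeg_vhcomp)
    have pdeg: "has_pdeg \<epsilon> d" if "\<epsilon> \<in> {\<eta>\<in>D. has_pdeg \<eta> d}" for \<epsilon>
      using that by blast
    have "vec_of_int (vhcomp d \<zeta>) \<in> V"
      by (rule descent[where D = "{\<eta>\<in>D. has_pdeg \<eta> d}" and d = d, OF p2 V]) (fact pdeg step \<zeta>_D)+
    then have "Poly_Mapping.single 0 (of_int c) *s vhcomp d \<eta> \<in> V"
      unfolding vhcomp_vec_of_int[symmetric] \<zeta> vhcomp_const_smult .
    then have "Poly_Mapping.single 0 (1 / of_int c) *s (Poly_Mapping.single 0 (of_int c) *s vhcomp d \<eta>) \<in> V"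
      by (rule vec_mod.subspace_scale[OF V])
    then show ?thesis
      unfolding vec_mod.scale_scale single_mult_single_0 using c by simp
  qed
  have "log_derivations A \<subseteq> V"
  proof
    fix \<eta> assume \<eta>: "\<eta> \<in> log_derivations A"
    show "\<eta> \<in> V"
      by (subst sum_vhcomp) (intro vec_mod.subspace_sum[OF V] homog_V[OF \<eta>])
  qed
  with V_sub have span: "V = log_derivations A" by blast

  \<comment> \<open>Independence over the rationals and conclusion\<close>
  have "\<And>f i. (\<Sum>i\<in>UNIV. f i *s (vec_of_int (\<theta> i) :: ('l, 'p mod_ring) mpoly ^ 'l)) = 0 \<Longrightarrow> f i = 0"
    using \<delta>(1,2) inj_independent_range_iff[of \<delta>] unfolding \<theta>_mod by blast
  then have "\<And>f i. (\<Sum>i\<in>UNIV. f i *s (vec_of_int (\<theta> i) :: ('l, rat) mpoly ^ 'l)) = 0 \<Longrightarrow> f i = 0"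
    by (rule lift_independence)
  then have ind: "inj (\<lambda>i. vec_of_int (\<theta> i) :: ('l, rat) mpoly ^ 'l)
      \<and> vec_mod.independent (range (\<lambda>i. vec_of_int (\<theta> i) :: ('l, rat) mpoly ^ 'l))"
    unfolding inj_independent_range_iff by blast
  have "has_pdeg (vec_of_int (\<theta> i) :: ('l, rat) mpoly ^ 'l) (e i)" for i
    using \<theta>_pdeg[of i] unfolding has_pdeg_def vec_of_int_nth by (blast intro: homogeneous_mpoly_of_int)
  with ind span show ?thesis
    unfolding free_with_exponents_def V_def by blast
qed

end
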